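(* Suppose that Condition A holds, $f\in\mathbb{C}^{(1)}_{[0,T]}$ and $f(0)=0$. Suppose that in the class $\mathbb{C}_{(0,T]}$ there exists a function $x^N(t)$ such that $$\Big(-\int_0^tK(t,s)x^N(s)\,ds+f(t)\Big)'=o(t^N)\qquad\text{as } t\to+0.$$ Then the integral equation $$\int_0^tK(t,s)x(s)\,ds=f(t),\qquad 0<t\le T,$$ has in the class $\mathbb{C}_{(0,T]}$ a solution of the form $$x(t)=x^N(t)+t^Nu(t),$$ where $u\in\mathbb{C}_{[0,T]}$, $u(t)\to0$ as $t\to+0$, and $u$ is uniquely determined and can be constructed by the method of successive approximations $u_{m+1}=Au_m+L_0^{-1}h$, which converge to $u$ in $\mathbb{C}_{[0,T]}$ for an arbitrary initial approximation $u_0\in\mathbb{C}_{[0,T]}$.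
   Context: Setting. Let $T>0$, $n\ge1$, and $0=\alpha_0<\alpha_1<\dots<\alpha_{n-1}<\alpha_n=1$. For $i=1,\dots,n$ let $K_i(t,s)$ be a real function on $\{0\le s\le t\le T\}$, continuous together with its partial derivative $K_i'(t,s)=\partial K_i(t,s)/\partial t$, and put $K(t,s)=K_i(t,s)$ for $\alpha_{i-1}t\le s<\alpha_i t$, $i=1,\dots,n$ (with $s=t$ included for $i=n$). The function $f$ is real valued. Condition A. $K_n(t,t)\ne0$ for all $t\in[0,T]$, and the integer $N\ge0$ is such that, for some $q<1$, $$\max_{0\le t\le T}|K_n(t,t)|^{-1}\sum_{i=1}^n\Big(\alpha_i^{1+N}|K_i(t,\alpha_it)|+\alpha_{i-1}^{1+N}|K_i(t,\alpha_{i-1}t)|\Big)\le 1+q .$$ $\mathbb{C}_{[0,T]}$ is the space of continuous real functions on $[0,T]$ with the maximum norm; $\mathbb{C}_{(0,T]}$ is the class of continuous real functions on $(0,T]$ which have a finite limit as $t\to+0$. Successive approximations. Define on $\mathbb{C}_{[0,T]}$ the operator $$(L_0u)(t)=\frac{1}{K_n(t,t)}\sum_{i=1}^n\Big(\alpha_i^{1+N}K_i(t,\alpha_it)u(\alpha_it)-\alpha_{i-1}^{1+N}K_i(t,\alpha_{i-1}t)u(\alpha_{i-1}t)\Big),$$ which under Condition A has a bounded inverse, and $Au=-L_0^{-1}v$, where $v(t)=\sum_{i=1}^n\int_{\alpha_{i-1}t}^{\alpha_it}\frac{K_i'(t,s)}{K_n(t,t)}(s/t)^Nu(s)\,ds$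 for $t>0$, $v(0)=0$. Put $g(t)=f(t)-\int_0^tK(t,s)x^N(s)\,ds$ and $h(t)=t^{-N}g'(t)/K_n(t,t)$ for $t>0$, $h(0)=0$. *)

theory Defs
  imports "HOL-Analysis.Analysis" "HOL-Library.Landau_Symbols"
begin

text \<open>
  The space of continuous real functions on \<open>[0,T]\<close> with the maximum norm.  Its points are
  extensional on \<open>{0..T}\<close>, so they are determined by their values there.
\<close>

abbreviation C_closed :: "real \<Rightarrow> (real \<Rightarrow> real) metric" where
  "C_closed T \<equiv> cfunspace (top_of_set {0..T}) euclidean_metric"

lemma mem_C_closed_iff:
  "u \<in> mspace (C_closed T) \<longleftrightarrow> u \<in> extensional {0..T} \<and> continuous_on {0..T} u"
  by (subst compactin_mspace_cfunspace) (auto simp: compactin_subtopology)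

lemma restrict_mem_C_closed: "continuous_on {0..T} g \<Longrightarrow> (\<lambda>t\<in>{0..T}. g t) \<in> mspace (C_closed T)"
  unfolding mem_C_closed_iff by (simp cong: continuous_on_cong_simp)

text \<open>Continuous on \<open>(0,T]\<close> with a finite limit at \<open>+0\<close>; values outside \<open>(0,T]\<close> are ignored.\<close>

definition C_half_open :: "real \<Rightarrow> (real \<Rightarrow> real) set" where
  "C_half_open T = {x. continuous_on {0<..T} x \<and> (\<exists>l. (x \<longlongrightarrow> l) (at_right 0))}"

text \<open>
  Continuously differentiable on \<open>[0,T]\<close>, with one-sided derivatives at the end points.
\<close>

definition C1_closed :: "real \<Rightarrow> (real \<Rightarrow> real) set" where
  "C1_closed T = {f. \<exists>f'. continuous_on {0..T} f' \<and>
      (\<forall>t\<in>{0..T}. (f has_real_derivative f' t) (at t within {0..T}))}"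

definition triangle :: "real \<Rightarrow> (real \<times> real) set" where
  "triangle T = {(t, s). 0 \<le> s \<and> s \<le> t \<and> t \<le> T}"

text \<open>
  \<open>k\<close> is continuous on the triangle together with its partial derivative \<open>k'\<close> in the first
  argument, which is taken within the domain \<open>[s,T]\<close> of \<open>k(\<cdot>,s)\<close>.  At the vertex \<open>(T,T)\<close>, where
  this domain is a point, \<open>k'\<close> is determined by its continuity.
\<close>

definition C1_kernel :: "real \<Rightarrow> (real \<Rightarrow> real \<Rightarrow> real) \<Rightarrow> (real \<Rightarrow> real \<Rightarrow> real) \<Rightarrow> bool" where
  "C1_kernel T k k' \<longleftrightarrow>
     continuous_on (triangle T) (\<lambda>(t, s). k t s) \<and>
     continuous_on (triangle T) (\<lambda>(t, s). k' t s) \<and>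
     (\<forall>(t, s)\<in>triangle T. ((\<lambda>\<tau>. k \<tau> s) has_real_derivative k' t s) (at t within {s..T}))"

definition piecewise_kernel ::
  "nat \<Rightarrow> (nat \<Rightarrow> real) \<Rightarrow> (nat \<Rightarrow> real \<Rightarrow> real \<Rightarrow> real) \<Rightarrow> real \<Rightarrow> real \<Rightarrow> real" where
  "piecewise_kernel n \<alpha> K t s =
     (if s = t then K n t t
      else K (THE i. i \<in> {1..n} \<and> \<alpha> (i - 1) * t \<le> s \<and> s < \<alpha> i * t) t s)"

definition condition_A ::
  "nat \<Rightarrow> (nat \<Rightarrow> real) \<Rightarrow> (nat \<Rightarrow> real \<Rightarrow> real \<Rightarrow> real) \<Rightarrow> real \<Rightarrow> nat \<Rightarrow> bool" where
  "condition_A n \<alpha> K T N \<longleftrightarrow>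
     (\<forall>t\<in>{0..T}. K n t t \<noteq> 0) \<and>
     (\<exists>q<1. \<forall>t\<in>{0..T}.
        inverse \<bar>K n t t\<bar> *
          (\<Sum>i=1..n. \<alpha> i ^ (1 + N) * \<bar>K i t (\<alpha> i * t)\<bar>
                   + \<alpha> (i - 1) ^ (1 + N) * \<bar>K i t (\<alpha> (i - 1) * t)\<bar>) \<le> 1 + q)"

definition solves_equation ::
  "nat \<Rightarrow> (nat \<Rightarrow> real) \<Rightarrow> (nat \<Rightarrow> real \<Rightarrow> real \<Rightarrow> real) \<Rightarrow> real \<Rightarrow> (real \<Rightarrow> real) \<Rightarrow> (real \<Rightarrow> real) \<Rightarrow> bool"
  where
  "solves_equation n \<alpha> K T f x \<longleftrightarrow>
     (\<forall>t\<in>{0<..T}. ((\<lambda>s. piecewise_kernel n \<alpha> K t s * x s) has_integral f t) {0..t})"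

definition L\<^sub>0 ::
  "nat \<Rightarrow> (nat \<Rightarrow> real) \<Rightarrow> (nat \<Rightarrow> real \<Rightarrow> real \<Rightarrow> real) \<Rightarrow> real \<Rightarrow> nat \<Rightarrow> (real \<Rightarrow> real) \<Rightarrow> real \<Rightarrow> real"
  where
  "L\<^sub>0 n \<alpha> K T N u = (\<lambda>t\<in>{0..T}. 1 / K n t t *
     (\<Sum>i=1..n. \<alpha> i ^ (1 + N) * K i t (\<alpha> i * t) * u (\<alpha> i * t)
              - \<alpha> (i - 1) ^ (1 + N) * K i t (\<alpha> (i - 1) * t) * u (\<alpha> (i - 1) * t)))"

definition L\<^sub>0_inv ::
  "nat \<Rightarrow> (nat \<Rightarrow> real) \<Rightarrow> (nat \<Rightarrow> real \<Rightarrow> real \<Rightarrow> real) \<Rightarrow> real \<Rightarrow> nat \<Rightarrow> (real \<Rightarrow> real) \<Rightarrow> real \<Rightarrow> real"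
  where
  "L\<^sub>0_inv n \<alpha> K T N = inv_into (mspace (C_closed T)) (L\<^sub>0 n \<alpha> K T N)"

definition V_op ::
  "nat \<Rightarrow> (nat \<Rightarrow> real) \<Rightarrow> (nat \<Rightarrow> real \<Rightarrow> real \<Rightarrow> real) \<Rightarrow> (nat \<Rightarrow> real \<Rightarrow> real \<Rightarrow> real) \<Rightarrow>
    real \<Rightarrow> nat \<Rightarrow> (real \<Rightarrow> real) \<Rightarrow> real \<Rightarrow> real"
  where
  "V_op n \<alpha> K K' T N u = (\<lambda>t\<in>{0..T}. if t = 0 then 0 else
     (\<Sum>i=1..n. integral {\<alpha> (i - 1) * t..\<alpha> i * t} (\<lambda>s. K' i t s / K n t t * (s / t) ^ N * u s)))"

definition A_op ::
  "nat \<Rightarrow> (nat \<Rightarrow> real) \<Rightarrow> (nat \<Rightarrow> real \<Rightarrow> real \<Rightarrow> real) \<Rightarrow> (nat \<Rightarrow> real \<Rightarrow> real \<Rightarrow> real) \<Rightarrow>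
    real \<Rightarrow> nat \<Rightarrow> (real \<Rightarrow> real) \<Rightarrow> real \<Rightarrow> real"
  where
  "A_op n \<alpha> K K' T N u = (\<lambda>t\<in>{0..T}. - L\<^sub>0_inv n \<alpha> K T N (V_op n \<alpha> K K' T N u) t)"

definition residual ::
  "nat \<Rightarrow> (nat \<Rightarrow> real) \<Rightarrow> (nat \<Rightarrow> real \<Rightarrow> real \<Rightarrow> real) \<Rightarrow> (real \<Rightarrow> real) \<Rightarrow> (real \<Rightarrow> real) \<Rightarrow> real \<Rightarrow> real"
  where
  "residual n \<alpha> K f xN t = f t - integral {0..t} (\<lambda>s. piecewise_kernel n \<alpha> K t s * xN s)"

text \<open>The derivative is one-sided at \<open>t = T\<close>.\<close>

definition residual_deriv ::
  "nat \<Rightarrow> (nat \<Rightarrow> real) \<Rightarrow> (nat \<Rightarrow> real \<Rightarrow> real \<Rightarrow> real) \<Rightarrow> real \<Rightarrow> (real \<Rightarrow> real) \<Rightarrow> (real \<Rightarrow> real) \<Rightarrow>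
    real \<Rightarrow> real"
  where
  "residual_deriv n \<alpha> K T f xN t = vector_derivative (residual n \<alpha> K f xN) (at t within {0..T})"

definition h_fun ::
  "nat \<Rightarrow> (nat \<Rightarrow> real) \<Rightarrow> (nat \<Rightarrow> real \<Rightarrow> real \<Rightarrow> real) \<Rightarrow> real \<Rightarrow> nat \<Rightarrow> (real \<Rightarrow> real) \<Rightarrow> (real \<Rightarrow> real) \<Rightarrow>
    real \<Rightarrow> real"
  where
  "h_fun n \<alpha> K T N f xN = (\<lambda>t\<in>{0..T}. if t = 0 then 0 else
     inverse (t ^ N) * residual_deriv n \<alpha> K T f xN t / K n t t)"

text \<open>
  Under condition A the operator \<open>L\<^sub>0\<close> is a bijection of \<open>C[0,T]\<close>, and its inverse is bounded.
  Hence \<open>inv_into\<close> in the definition of \<open>L\<^sub>0_inv\<close> is the genuine inverse operator.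
\<close>

lemma alpha_bounds:
  fixes \<alpha> :: "nat \<Rightarrow> real"
  assumes "\<alpha> 0 = 0" "\<alpha> n = 1" "\<forall>i<n. \<alpha> i < \<alpha> (Suc i)" "i \<le> n"
  shows "0 \<le> \<alpha> i" "\<alpha> i \<le> 1"
proof -
  have mono: "\<alpha> j \<le> \<alpha> k" if "j \<le> k" "k \<le> n" for j k
    using that
  proof (induction k rule: dec_induct)
    case (step m)
    then show ?case using assms(3)[rule_format, of m] by simp
  qed simp
  show "0 \<le> \<alpha> i" "\<alpha> i \<le> 1"
    using mono[of 0 i] mono[of i n] assms by auto
qed

lemma scaled_mem: "0 \<le> a \<Longrightarrow> a \<le> 1 \<Longrightarrow> t \<in> {0..T} \<Longrightarrow> a * t \<in> {0..T}" for a t T :: real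
  using mult_right_mono[of a 1 t] by auto

lemma L0_sum_bound:
  fixes a b :: "nat \<Rightarrow> real" and d :: "real \<Rightarrow> real" and c :: real
  assumes "1 \<le> n" "c \<noteq> 0" "a n = c" "p n = t"
    and "\<And>i. i \<in> {1..n} \<Longrightarrow> \<bar>d (p i)\<bar> \<le> M" "\<And>i. i \<in> {1..n} \<Longrightarrow> \<bar>d (r i)\<bar> \<le> M"
    and "inverse \<bar>c\<bar> * (\<Sum>i=1..n. \<bar>a i\<bar> + \<bar>b i\<bar>) \<le> 1 + q"
  shows "\<bar>1 / c * (\<Sum>i=1..n. a i * d (p i) - b i * d (r i)) - d t\<bar> \<le> q * M"
proof -
  define S where "S = (\<Sum>i=1..n. a i * d (p i) - b i * d (r i)) - c * d t"
  have M: "0 \<le> M"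
    using assms(5)[of 1] \<open>1 \<le> n\<close> by fastforce
  have split: "{1..n} = insert n {1..<n}"
    using \<open>1 \<le> n\<close> by auto
  have "S = (\<Sum>i=1..<n. a i * d (p i)) - (\<Sum>i=1..n. b i * d (r i))"
    unfolding S_def sum_subtractf
    by (subst split) (simp add: assms(3,4))
  also have "\<bar>\<dots>\<bar> \<le> (\<Sum>i=1..<n. \<bar>a i * d (p i)\<bar>) + (\<Sum>i=1..n. \<bar>b i * d (r i)\<bar>)"
    by (rule order_trans[OF abs_triangle_ineq4 add_mono[OF sum_abs sum_abs]])
  also have "\<dots> \<le> (\<Sum>i=1..<n. \<bar>a i\<bar> * M) + (\<Sum>i=1..n. \<bar>b i\<bar> * M)"
    by (intro add_mono sum_mono) (auto simp: abs_mult intro!: mult_left_mono assms(5,6))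
  also have "\<dots> = ((\<Sum>i=1..n. \<bar>a i\<bar> + \<bar>b i\<bar>) - \<bar>c\<bar>) * M"
    unfolding sum.distrib sum_distrib_right[symmetric]
    using sum.remove[of "{1..n}" n "\<lambda>i. \<bar>a i\<bar>"] \<open>1 \<le> n\<close>
    by (simp add: assms(3) algebra_simps split insert_Diff_if del: One_nat_def)
  also have "\<dots> \<le> (\<bar>c\<bar> * q) * M"
    using assms(2,7) M by (intro mult_right_mono) (simp_all add: field_simps)
  finally have "\<bar>S\<bar> \<le> \<bar>c\<bar> * (q * M)"
    by (simp add: mult.assoc)
  moreover have "1 / c * (\<Sum>i=1..n. a i * d (p i) - b i * d (r i)) - d t = S / c"
    using assms(2) by (simp add: S_def field_simps)
  ultimately show ?thesis
    using assms(2) by (simp add: field_simps)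
qed

lemma L0_near_identity:
  assumes "1 \<le> n" "\<alpha> 0 = 0" "\<alpha> n = 1" "\<forall>i<n. \<alpha> i < \<alpha> (Suc i)"
    and "K n t t \<noteq> 0" "t \<in> {0..T}"
    and q: "inverse \<bar>K n t t\<bar> *
          (\<Sum>i=1..n. \<alpha> i ^ (1 + N) * \<bar>K i t (\<alpha> i * t)\<bar>
                   + \<alpha> (i - 1) ^ (1 + N) * \<bar>K i t (\<alpha> (i - 1) * t)\<bar>) \<le> 1 + q"
    and M: "\<And>s. s \<in> {0..T} \<Longrightarrow> \<bar>u s - w s\<bar> \<le> M"
  shows "\<bar>(L\<^sub>0 n \<alpha> K T N u t - u t) - (L\<^sub>0 n \<alpha> K T N w t - w t)\<bar> \<le> q * M"
proof -
  note ab = alpha_bounds[OF assms(2-4)]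
  have mem: "\<alpha> i * t \<in> {0..T}" if "i \<le> n" for i
    using scaled_mem ab[OF that] assms(6) by blast
  have "(\<Sum>i=1..n. \<bar>\<alpha> i ^ (1 + N) * K i t (\<alpha> i * t)\<bar>
                 + \<bar>\<alpha> (i - 1) ^ (1 + N) * K i t (\<alpha> (i - 1) * t)\<bar>)
      = (\<Sum>i=1..n. \<alpha> i ^ (1 + N) * \<bar>K i t (\<alpha> i * t)\<bar>
                 + \<alpha> (i - 1) ^ (1 + N) * \<bar>K i t (\<alpha> (i - 1) * t)\<bar>)"
    using ab(1) by (intro sum.cong) (auto simp: abs_mult)
  then have "\<bar>1 / K n t t *
      (\<Sum>i=1..n. \<alpha> i ^ (1 + N) * K i t (\<alpha> i * t) * (u (\<alpha> i * t) - w (\<alpha> i * t))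
        - \<alpha> (i - 1) ^ (1 + N) * K i t (\<alpha> (i - 1) * t) * (u (\<alpha> (i - 1) * t) - w (\<alpha> (i - 1) * t)))
      - (u t - w t)\<bar> \<le> q * M"
    using assms(1,3,5) q
    by (intro L0_sum_bound[where d = "\<lambda>s. u s - w s"]) (auto intro!: M mem)
  also have "1 / K n t t *
      (\<Sum>i=1..n. \<alpha> i ^ (1 + N) * K i t (\<alpha> i * t) * (u (\<alpha> i * t) - w (\<alpha> i * t))
        - \<alpha> (i - 1) ^ (1 + N) * K i t (\<alpha> (i - 1) * t) * (u (\<alpha> (i - 1) * t) - w (\<alpha> (i - 1) * t)))
      = L\<^sub>0 n \<alpha> K T N u t - L\<^sub>0 n \<alpha> K T N w t"
    using assms(6)
    by (simp only: L\<^sub>0_def restrict_apply if_True right_diff_distrib[symmetric]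
        sum_subtractf[symmetric]) (simp add: algebra_simps)
  finally show ?thesis
    by (simp add: algebra_simps)
qed

lemma L0_continuous:
  assumes "1 \<le> n" "\<alpha> 0 = 0" "\<alpha> n = 1" "\<forall>i<n. \<alpha> i < \<alpha> (Suc i)"
    and K: "\<forall>i\<in>{1..n}. continuous_on (triangle T) (\<lambda>(t, s). K i t s)"
    and "\<forall>t\<in>{0..T}. K n t t \<noteq> 0"
    and u: "u \<in> mspace (C_closed T)"
  shows "L\<^sub>0 n \<alpha> K T N u \<in> mspace (C_closed T)"
proof -
  note ab = alpha_bounds[OF assms(2-4)]
  have uc: "continuous_on {0..T} u"
    using u by (simp add: mem_C_closed_iff)
  have mem: "\<alpha> j * t \<in> {0..T}" "\<alpha> j * t \<le> t" if "j \<le> n" "t \<in> {0..T}" for j t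
    using scaled_mem[OF ab[OF that(1)] that(2)] mult_right_mono[OF ab(2)[OF that(1)], of t] that(2)
    by auto
  have Kc: "continuous_on {0..T} (\<lambda>t. K i t (\<alpha> j * t))" if "i \<in> {1..n}" "j \<le> n" for i j
    using continuous_on_compose2[OF K[rule_format, OF that(1)], of "{0..T}" "\<lambda>t. (t, \<alpha> j * t)"] mem[OF that(2)]
    by (force simp: triangle_def intro!: continuous_intros)
  have uj: "continuous_on {0..T} (\<lambda>t. u (\<alpha> j * t))" if "j \<le> n" for j
    using mem[OF that] by (intro continuous_on_compose2[OF uc]) (auto intro!: continuous_intros)
  have Kn: "continuous_on {0..T} (\<lambda>t. K n t t)"
    using Kc[of n n] assms(1,3) by simp
  have "continuous_on {0..T} (\<lambda>t. 1 / K n t t *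
     (\<Sum>i=1..n. \<alpha> i ^ (1 + N) * K i t (\<alpha> i * t) * u (\<alpha> i * t)
              - \<alpha> (i - 1) ^ (1 + N) * K i t (\<alpha> (i - 1) * t) * u (\<alpha> (i - 1) * t)))"
    using assms(6) by (intro continuous_intros Kn Kc uj) auto
  then show ?thesis
    unfolding L\<^sub>0_def by (rule restrict_mem_C_closed)
qed

theorem L0_bounded_inverse:
  assumes T: "0 < T" and n: "1 \<le> n" "\<alpha> 0 = 0" "\<alpha> n = 1" "\<forall>i<n. \<alpha> i < \<alpha> (Suc i)"
    and K: "\<forall>i\<in>{1..n}. continuous_on (triangle T) (\<lambda>(t, s). K i t s)"
    and A: "condition_A n \<alpha> K T N"
  shows "bij_betw (L\<^sub>0 n \<alpha> K T N) (mspace (C_closed T)) (mspace (C_closed T))"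
    and "\<exists>B. \<forall>v\<in>mspace (C_closed T). \<forall>w\<in>mspace (C_closed T).
           mdist (C_closed T) (L\<^sub>0_inv n \<alpha> K T N v) (L\<^sub>0_inv n \<alpha> K T N w) \<le> B * mdist (C_closed T) v w"
proof -
  let ?C = "mspace (C_closed T)" and ?d = "mdist (C_closed T)" and ?L = "L\<^sub>0 n \<alpha> K T N"
  obtain q where q1: "q < 1" and q: "\<And>t. t \<in> {0..T} \<Longrightarrow> inverse \<bar>K n t t\<bar> *
          (\<Sum>i=1..n. \<alpha> i ^ (1 + N) * \<bar>K i t (\<alpha> i * t)\<bar>
                   + \<alpha> (i - 1) ^ (1 + N) * \<bar>K i t (\<alpha> (i - 1) * t)\<bar>) \<le> 1 + q"
    and nz: "\<forall>t\<in>{0..T}. K n t t \<noteq> 0"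
    using A unfolding condition_A_def by blast
  interpret M: Metric_space ?C ?d
    by (rule Metric_space_mspace_mdist)
  have "Met_TC.mcomplete TYPE(real)"
    by (simp add: mcomplete_iff_complete complete_UNIV)
  then have complete: "M.mcomplete"
    using Met_TC.mcomplete_cfunspace[where 'a = real, of "top_of_set {0..T}"]
    by (simp add: mcomplete_of_def Met_TC.Self_def euclidean_metric_def)
  have closed: "?L u \<in> ?C" if "u \<in> ?C" for u
    using L0_continuous[OF n K nz that] .
  have ptw: "\<bar>u s - w s\<bar> \<le> ?d u w" if "u \<in> ?C" "w \<in> ?C" "s \<in> {0..T}" for u w s
    using mdist_cfunspace_imp_mdist_le[OF that(1,2) order_refl, of s] that(3)
    by (simp add: dist_real_def)
  have near: "\<bar>(?L u t - u t) - (?L w t - w t)\<bar> \<le> q * ?d u w"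
    if "u \<in> ?C" "w \<in> ?C" "t \<in> {0..T}" for u w t
    using L0_near_identity[of n \<alpha> K t T N q u w, OF n nz[rule_format, OF that(3)] that(3)
        q[OF that(3)] ptw[OF that(1,2)]] .
  have leI: "?d u w \<le> B" if "u \<in> ?C" "w \<in> ?C" "\<And>s. s \<in> {0..T} \<Longrightarrow> \<bar>u s - w s\<bar> \<le> B" for u w B
    using cfunspace_mdist_le[OF that(1,2), of B] that(3) T by (simp add: dist_real_def)
  have lower: "(1 - q) * ?d u w \<le> ?d (?L u) (?L w)" if "u \<in> ?C" "w \<in> ?C" for u w
  proof -
    have "?d u w \<le> ?d (?L u) (?L w) + q * ?d u w"
    proof (rule leI[OF that])
      fix s assume s: "s \<in> {0..T}"
      show "\<bar>u s - w s\<bar> \<le> ?d (?L u) (?L w) + q * ?d u w"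
        using near[OF that s] ptw[OF closed closed s, of u w] that by linarith
    qed
    then show ?thesis by (simp add: algebra_simps)
  qed
  have inj: "inj_on ?L ?C"
  proof (rule inj_onI)
    fix u w assume uw: "u \<in> ?C" "w \<in> ?C" "?L u = ?L w"
    then have "(1 - q) * ?d u w \<le> 0"
      using lower[OF uw(1,2)] closed by simp
    then have "?d u w \<le> 0"
      using q1 by (simp add: mult_le_0_iff)
    then show "u = w"
      using uw M.nonneg[of u w] M.zero[of u w] by simp
  qed
  have surj: "\<exists>u\<in>?C. ?L u = v" if v: "v \<in> ?C" for v
  proof -
    define P where "P u = (\<lambda>t\<in>{0..T}. v t - (?L u t - u t))" for u
    have PC: "P u \<in> ?C" if "u \<in> ?C" for u
    proof -
      have "continuous_on {0..T} (\<lambda>t. v t - (?L u t - u t))"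
        using that v closed[OF that] unfolding mem_C_closed_iff by (intro continuous_intros) auto
      then show ?thesis
        unfolding P_def by (rule restrict_mem_C_closed)
    qed
    have "?d (P u) (P w) \<le> q * ?d u w" if "u \<in> ?C" "w \<in> ?C" for u w
    proof (rule leI[OF PC[OF that(1)] PC[OF that(2)]])
      fix s assume s: "s \<in> {0..T}"
      show "\<bar>P u s - P w s\<bar> \<le> q * ?d u w"
        using near[OF that s] s by (simp add: P_def)
    qed
    moreover have "?C \<noteq> {}" "P \<in> ?C \<rightarrow> ?C"
      using v PC by (fast, fast)
    ultimately obtain u where u: "u \<in> ?C" "P u = u"
      using M.Banach_fixedpoint_thm[OF complete, of P q] q1 by metis
    have "?L u t = v t" for t
    proof (cases "t \<in> {0..T}")
      case True
      then show ?thesis using fun_cong[OF u(2), of t] by (simp add: P_def)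
    next
      case False
      then show ?thesis
        using closed[OF u(1)] v unfolding mem_C_closed_iff by (metis extensional_arb)
    qed
    then show ?thesis using u(1) by blast
  qed
  show bij: "bij_betw ?L ?C ?C"
    unfolding bij_betw_def using inj closed surj by blast
  have "?d (L\<^sub>0_inv n \<alpha> K T N v) (L\<^sub>0_inv n \<alpha> K T N w) \<le> 1 / (1 - q) * ?d v w"
    if "v \<in> ?C" "w \<in> ?C" for v w
  proof -
    have im: "v \<in> ?L ` ?C" "w \<in> ?L ` ?C"
      using that bij_betw_imp_surj_on[OF bij] by simp_all
    show ?thesis
      using lower[OF inv_into_into[OF im(1)] inv_into_into[OF im(2)]] q1
      by (simp add: L\<^sub>0_inv_def f_inv_into_f[OF im(1)] f_inv_into_f[OF im(2)] field_simps
          del: mspace_cfunspace)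
  qed
  then show "\<exists>B. \<forall>v\<in>?C. \<forall>w\<in>?C. ?d (L\<^sub>0_inv n \<alpha> K T N v) (L\<^sub>0_inv n \<alpha> K T N w) \<le> B * ?d v w"
    by blast
qed

end

theory Submission
  imports Defs
begin

text \<open>
  Write the unknown as \<open>x = x\<^sup>N + t\<^sup>N u\<close>.  The equation of the first kind has two sides that vanish at
  \<open>t = 0\<close>, so it is equivalent to its derivative.  Differentiating sector by sector with the Leibniz
  rule (\<open>has_real_derivative_integral_C1_kernel\<close>) and dividing by \<open>t\<^sup>N K\<^sub>n(t,t)\<close> turns it into the equation
  of the second kind \<open>L u + V u = h\<close> on \<open>[0,T]\<close> (\<open>differentiated_equation\<close>), where \<open>L\<close> is the operator \<open>L\<^sub>0\<close>
  collecting the boundary terms and \<open>V\<close> collects the integrals.  The condition on \<open>x\<^sup>N\<close> says that \<open>h\<close>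
  is continuous with \<open>h(0) = 0\<close>.  The solutions \<open>u\<close> are the fixed points of the map
  \<open>u \<mapsto> A u + L\<^sup>-\<^sup>1 h\<close>, \<open>A = -L\<^sup>-\<^sup>1 V\<close>.
  
  In the maximum norm this map need not contract, but it does in the norm \<open>max \<bar>u(t)\<bar> exp (-\<rho> t)\<close> for
  large \<open>\<rho>\<close>.  On the one hand, \<open>L\<close> is causal and differs from the identity by a map with Lipschitz
  constant \<open>q < 1\<close>; since the weight \<open>exp (\<rho> t)\<close> increases, this persists for every \<open>\<rho>\<close>, and the
  inverse of \<open>L\<close> is bounded by \<open>1/(1 - q)\<close> uniformly in \<open>\<rho>\<close> (\<open>L_inverse_exp_bound\<close>).  On the other hand,
  \<open>V\<close> is an integral operator, and integrating \<open>exp (\<rho> s)\<close> gains \<open>1/\<rho>\<close> (\<open>V_bound\<close>).  Hence the map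
  contracts by \<open>1/2\<close> for a suitable \<open>\<rho>\<close>, and in the maximum norm its \<open>m\<close>-th iterate has Lipschitz
  constant at most \<open>exp (\<rho> T) / 2\<^sup>m\<close>.  This yields existence, uniqueness and convergence from any
  initial approximation (\<open>successive_approximations\<close>).  Finally \<open>u(0) = 0\<close>, because at \<open>t = 0\<close> the
  equation reduces to a nonzero multiple of \<open>u(0)\<close> being \<open>0\<close> (\<open>zero_at_0_if_homogeneous_at_0\<close>).
\<close>

section \<open>Differentiating integrals with moving end points\<close>

lemma continuous_on_compose_pair:
  assumes "continuous_on D (\<lambda>(t, s). k t s)" "continuous_on S p" "continuous_on S r"
    and "\<And>x. x \<in> S \<Longrightarrow> (p x, r x) \<in> D"
  shows "continuous_on S (\<lambda>x. k (p x) (r x))"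
  using continuous_on_compose2[OF assms(1) continuous_on_Pair[OF assms(2,3)]] assms(4)
  by auto

text \<open>
  The chain rule along the segment \<open>t \<mapsto> (t, c t)\<close> for \<open>(t, x) \<mapsto> \<integral>\<^sub>0\<^sup>x F(t,s) ds\<close>.  This function of two variables is
  differentiable because its partial derivative in \<open>x\<close> is the jointly continuous \<open>F\<close>, while the one
  in \<open>t\<close> comes from differentiating under the integral sign.
\<close>

lemma has_real_derivative_integral_moving_endpoint:
  fixes F F' :: "real \<Rightarrow> real \<Rightarrow> real"
  assumes F: "continuous_on ({0..T} \<times> {0..T}) (\<lambda>(t, s). F t s)"
    and F': "continuous_on ({0..T} \<times> {0..T}) (\<lambda>(t, s). F' t s)"
    and deriv: "\<And>t s. t \<in> {0..T} \<Longrightarrow> s \<in> {0..T} \<Longrightarrow>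
        ((\<lambda>\<tau>. F \<tau> s) has_real_derivative F' t s) (at t within {0..T})"
    and c: "0 \<le> c" "c \<le> 1" and t: "t \<in> {0..T}"
  shows "((\<lambda>t. integral {0..c * t} (F t)) has_real_derivative
      c * F t (c * t) + integral {0..c * t} (F' t)) (at t within {0..T})"
proof -
  let ?Q = "{0..T} \<times> {0..T}"
  have ct: "c * \<tau> \<in> {0..T}" if "\<tau> \<in> {0..T}" for \<tau>
    using scaled_mem[OF c that] .
  have cont: "continuous_on {0..T} (F \<tau>)" if "\<tau> \<in> {0..T}" for \<tau>
    by (rule continuous_on_compose_pair[OF F]) (use that in \<open>auto intro!: continuous_intros\<close>)
  have int: "F \<tau> integrable_on {0..x}" if "\<tau> \<in> {0..T}" "x \<in> {0..T}" for \<tau> x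
    using that by (intro integrable_continuous_real continuous_on_subset[OF cont]) auto
  have fst_part: "((\<lambda>\<tau>. integral {0..c * t} (F \<tau>)) has_real_derivative integral {0..c * t} (F' t))
      (at t within {0..T})"
  proof -
    have "((\<lambda>\<tau>. integral (cbox 0 (c * t)) (F \<tau>)) has_field_derivative integral (cbox 0 (c * t)) (F' t))
        (at t within {0..T})"
    proof (rule leibniz_rule_field_derivative)
      show "continuous_on ({0..T} \<times> cbox 0 (c * t)) (\<lambda>(t, s). F' t s)"
        by (rule continuous_on_subset[OF F']) (use ct[OF t] in auto)
    qed (use ct[OF t] t int deriv in auto)
    then show ?thesis by simp
  qed
  have "((\<lambda>(\<tau>, x). integral {0..x} (F \<tau>)) has_derivative
      (\<lambda>(d, e). (integral {0..c * t} (F' t) * d) + blinfun_mult_right (F t (c * t)) e)) (at (t, c * t) within ?Q)"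
  proof (rule has_derivative_partialsI[where fy = "\<lambda>\<tau> x. blinfun_mult_right (F \<tau> x)"])
    show "((\<lambda>x. integral {0..c * t} (F x)) has_derivative (*) (integral {0..c * t} (F' t)))
        (at t within {0..T})"
      using fst_part by (simp add: has_field_derivative_def)
    show "((\<lambda>y. integral {0..y} (F \<tau>)) has_derivative blinfun_apply (blinfun_mult_right (F \<tau> x)))
        (at x within {0..T})" if "\<tau> \<in> {0..T}" "x \<in> {0..T}" for \<tau> x
      using integral_has_real_derivative[OF cont[OF that(1)] that(2)]
      by (simp add: has_field_derivative_def mult.commute[of _ "F \<tau> x"])
    have "continuous_on ?Q (\<lambda>p. blinfun_mult_right (F (fst p) (snd p)))"
      using F by (intro continuous_intros) (simp add: case_prod_unfold)
    then show "continuous (at (t, c * t) within ?Q) (\<lambda>(\<tau>, x). blinfun_mult_right (F \<tau> x))"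
      using t ct[OF t] by (simp add: case_prod_unfold continuous_on_eq_continuous_within)
  qed (use ct[OF t] in auto)
  then have D: "((\<lambda>(\<tau>, x). integral {0..x} (F \<tau>)) has_derivative
      (\<lambda>(d, e). (integral {0..c * t} (F' t) * d) + blinfun_mult_right (F t (c * t)) e))
      (at ((\<lambda>\<tau>. (\<tau>, c * \<tau>)) t) within (\<lambda>\<tau>. (\<tau>, c * \<tau>)) ` {0..T})"
    by (rule has_derivative_subset) (use ct in auto)
  have "((\<lambda>\<tau>. (\<tau>, c * \<tau>)) has_derivative (\<lambda>d. (d, c * d))) (at t within {0..T})"
    by (intro has_derivative_Pair has_derivative_ident has_derivative_mult_right)
  from has_derivative_in_compose[OF this D]
  have "((\<lambda>\<tau>. integral {0..c * \<tau>} (F \<tau>)) has_derivative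
      (\<lambda>d. integral {0..c * t} (F' t) * d + F t (c * t) * (c * d))) (at t within {0..T})"
    by simp
  moreover have "(\<lambda>d. integral {0..c * t} (F' t) * d + F t (c * t) * (c * d))
      = (*) (c * F t (c * t) + integral {0..c * t} (F' t))"
    by (simp add: fun_eq_iff algebra_simps)
  ultimately show ?thesis
    by (simp add: has_field_derivative_def)
qed

text \<open>
  The square \<open>[0,T]\<^sup>2\<close> is needed to vary the two arguments independently, but a kernel lives on the
  triangle only.  Above the diagonal it is continued linearly in \<open>t\<close>, with value and slope taken at
  \<open>(s,s)\<close>; then its \<open>t\<close>-derivative continues as the constant \<open>k'(s,s)\<close>, so that the continuation is again
  continuously differentiable in \<open>t\<close>, including at the corner \<open>(T,T)\<close>.
\<close>

definition extended_kernel :: "(real \<Rightarrow> real \<Rightarrow> real) \<Rightarrow> (real \<Rightarrow> real \<Rightarrow> real) \<Rightarrow> real \<Rightarrow> real \<Rightarrow> real"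
  where "extended_kernel k k' t s = k (max t s) s + min (t - s) 0 * k' s s"

lemma extended_kernel_eq: "s \<le> t \<Longrightarrow> extended_kernel k k' t s = k t s"
  by (simp add: extended_kernel_def max_def)

lemma continuous_on_triangle_max:
  assumes "continuous_on (triangle T) (\<lambda>(t, s). k t s)"
  shows "continuous_on ({0..T} \<times> {0..T}) (\<lambda>(t, s). k (max t s) s)"
  unfolding case_prod_unfold
  by (rule continuous_on_compose_pair[OF assms]) (auto simp: triangle_def intro!: continuous_intros)

lemma continuous_on_extended_kernel:
  assumes "C1_kernel T k k'"
  shows "continuous_on ({0..T} \<times> {0..T}) (\<lambda>(t, s). extended_kernel k k' t s)"
proof -
  have k: "continuous_on (triangle T) (\<lambda>(t, s). k t s)"
    and k': "continuous_on (triangle T) (\<lambda>(t, s). k' t s)"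
    using assms by (auto simp: C1_kernel_def)
  have "continuous_on ({0..T} \<times> {0..T}) (\<lambda>p. k' (snd p) (snd p))"
    by (rule continuous_on_compose_pair[OF k']) (auto simp: triangle_def intro!: continuous_intros)
  then show ?thesis
    using continuous_on_triangle_max[OF k]
    unfolding extended_kernel_def case_prod_unfold
    by (intro continuous_intros) auto
qed

lemma has_real_derivative_extended_kernel:
  assumes K: "C1_kernel T k k'" and t: "t \<in> {0..T}" and s: "s \<in> {0..T}"
  shows "((\<lambda>t. extended_kernel k k' t s) has_real_derivative k' (max t s) s) (at t within {0..T})"
proof -
  \<comment> \<open>The two branches meet at \<open>t = s\<close> with equal values and equal one-sided derivatives.\<close>
  have "((\<lambda>\<tau>. if \<tau> \<in> {s..T} then k \<tau> s else k s s + (\<tau> - s) * k' s s) has_vector_derivative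
      (if t \<in> {s..T} then k' (max t s) s else k' (max t s) s)) (at t within {0..T})"
  proof (rule has_vector_derivative_If_within_closures)
    show "{0..T} = {s..T} \<union> {0..s}"
      using s by auto
    have "{s..T} \<union> closure {s..T} \<inter> closure {0..s} = {s..T}"
      "{0..s} \<union> closure {s..T} \<inter> closure {0..s} = {0..s}"
      using s by auto
    note sets = this
    show "((\<lambda>\<tau>. k \<tau> s) has_vector_derivative k' (max t s) s)
        (at t within {s..T} \<union> closure {s..T} \<inter> closure {0..s})"
      if "t \<in> {s..T} \<union> closure {s..T} \<inter> closure {0..s}"
    proof -
      have st: "s \<le> t"
        using that unfolding sets by simp
      then have "((\<lambda>\<tau>. k \<tau> s) has_real_derivative k' t s) (at t within {s..T})"
        using K s t by (auto simp: C1_kernel_def triangle_def)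
      with st show ?thesis
        unfolding sets by (simp add: has_real_derivative_iff_has_vector_derivative max_def)
    qed
    show "((\<lambda>\<tau>. k s s + (\<tau> - s) * k' s s) has_vector_derivative k' (max t s) s)
        (at t within {0..s} \<union> closure {s..T} \<inter> closure {0..s})"
      if "t \<in> {0..s} \<union> closure {s..T} \<inter> closure {0..s}"
    proof -
      have "((\<lambda>\<tau>. k s s + (\<tau> - s) * k' s s) has_real_derivative k' s s) (at t within {0..s})"
        by (auto intro!: derivative_eq_intros)
      moreover have "max t s = s"
        using that unfolding sets by simp
      ultimately show ?thesis
        unfolding sets by (simp add: has_real_derivative_iff_has_vector_derivative)
    qed
  qed (use s t in auto)
  then have "((\<lambda>\<tau>. if \<tau> \<in> {s..T} then k \<tau> s else k s s + (\<tau> - s) * k' s s) has_real_derivative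
      k' (max t s) s) (at t within {0..T})"
    by (simp add: has_real_derivative_iff_has_vector_derivative)
  then show ?thesis
    by (rule has_field_derivative_transform_within[OF _ zero_less_one t])
      (auto simp: extended_kernel_def max_def min_def)
qed

text \<open>
  The Leibniz formula on the triangle.  For \<open>b = 1\<close> the difference quotients from the left leave the
  domain of the kernel; this is harmless for the integral, since on \<open>[a t, b t]\<close> the kernel coincides
  with its continuation.
\<close>

lemma has_real_derivative_integral_C1_kernel:
  assumes K: "C1_kernel T k k'" and y: "continuous_on {0..T} y"
    and ab: "0 \<le> a" "a \<le> b" "b \<le> 1" and t: "t \<in> {0..T}"
  shows "((\<lambda>t. integral {a * t..b * t} (\<lambda>s. k t s * y s)) has_real_derivative
      b * (k t (b * t) * y (b * t)) - a * (k t (a * t) * y (a * t))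
      + integral {a * t..b * t} (\<lambda>s. k' t s * y s)) (at t within {0..T})"
proof -
  define F where "F t s = extended_kernel k k' t s * y s" for t s
  define F' where "F' t s = k' (max t s) s * y s" for t s
  have k': "continuous_on (triangle T) (\<lambda>(t, s). k' t s)"
    using K by (auto simp: C1_kernel_def)
  have y2: "continuous_on ({0..T} \<times> {0..T}) (\<lambda>p. y (snd p))"
    by (rule continuous_on_compose2[OF y]) (auto intro!: continuous_intros)
  have F: "continuous_on ({0..T} \<times> {0..T}) (\<lambda>(t, s). F t s)"
    using continuous_on_extended_kernel[OF K] y2
    unfolding F_def case_prod_unfold by (intro continuous_intros) auto
  have F': "continuous_on ({0..T} \<times> {0..T}) (\<lambda>(t, s). F' t s)"
    using continuous_on_triangle_max[OF k'] y2
    unfolding F'_def case_prod_unfold by (intro continuous_intros) auto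
  have deriv: "((\<lambda>\<tau>. F \<tau> s) has_real_derivative F' t s) (at t within {0..T})"
    if "t \<in> {0..T}" "s \<in> {0..T}" for t s
    unfolding F_def F'_def
    using DERIV_cmult_right[OF has_real_derivative_extended_kernel[OF K that]] .
  have mem: "c * t \<in> {0..T}" "c * t \<le> t" if "0 \<le> c" "c \<le> 1" "t \<in> {0..T}" for c t
    using scaled_mem[OF that] mult_right_mono[OF that(2), of t] that(3) by auto
  have split: "integral {0..b * t} g - integral {0..a * t} g = integral {a * t..b * t} g"
    if "t \<in> {0..T}" "continuous_on {0..T} g" for g :: "real \<Rightarrow> real" and t
  proof -
    have "a * t \<le> b * t"
      using ab that(1) by (intro mult_right_mono) auto
    moreover have "g integrable_on {0..b * t}"
      using mem(1)[OF _ ab(3) that(1)] ab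
      by (intro integrable_continuous_real continuous_on_subset[OF that(2)]) auto
    ultimately show ?thesis
      using Henstock_Kurzweil_Integration.integral_combine[of 0 "a * t" "b * t" g] ab that(1)
      by (simp add: algebra_simps)
  qed
  have slice: "continuous_on {0..T} (G t)"
    if "continuous_on ({0..T} \<times> {0..T}) (\<lambda>(t, s). G t s)" "t \<in> {0..T}"
    for G :: "real \<Rightarrow> real \<Rightarrow> real" and t
    by (rule continuous_on_compose_pair[OF that(1)]) (use that(2) in \<open>auto intro!: continuous_intros\<close>)
  have D: "((\<lambda>t. integral {0..b * t} (F t) - integral {0..a * t} (F t)) has_real_derivative
      (b * F t (b * t) + integral {0..b * t} (F' t)) - (a * F t (a * t) + integral {0..a * t} (F' t)))
      (at t within {0..T})"
    using ab t
    by (intro DERIV_diff has_real_derivative_integral_moving_endpoint[OF F F' deriv]) auto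
  have eq: "integral {0..b * \<tau>} (F \<tau>) - integral {0..a * \<tau>} (F \<tau>)
      = integral {a * \<tau>..b * \<tau>} (\<lambda>s. k \<tau> s * y s)" if "\<tau> \<in> {0..T}" for \<tau>
    unfolding split[OF that slice[OF F that]]
    using mem(2)[OF _ ab(3) that] ab
    by (intro Henstock_Kurzweil_Integration.integral_cong) (simp add: F_def extended_kernel_eq)
  have eq': "integral {0..b * t} (F' t) - integral {0..a * t} (F' t)
      = integral {a * t..b * t} (\<lambda>s. k' t s * y s)"
    unfolding split[OF t slice[OF F' t]]
    using mem(2)[OF _ ab(3) t] ab
    by (intro Henstock_Kurzweil_Integration.integral_cong) (simp add: F'_def max_absorb1)
  have F_eq: "F t (c * t) = k t (c * t) * y (c * t)" if "0 \<le> c" "c \<le> 1" for c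
    using mem(2)[OF that t] by (simp add: F_def extended_kernel_eq)
  have "(b * F t (b * t) + integral {0..b * t} (F' t)) - (a * F t (a * t) + integral {0..a * t} (F' t))
      = b * (k t (b * t) * y (b * t)) - a * (k t (a * t) * y (a * t))
      + integral {a * t..b * t} (\<lambda>s. k' t s * y s)"
    using ab eq' F_eq[of a] F_eq[of b] by simp
  with D show ?thesis
    by (intro has_field_derivative_transform_within[OF _ zero_less_one t eq]) simp_all
qed

text \<open>
  Scaling to a fixed interval makes the dependence of the integral on \<open>t\<close> continuous by inspection,
  also at \<open>t = 0\<close>, where the moving interval collapses.
\<close>

lemma integral_scaled_interval:
  fixes g :: "real \<Rightarrow> real"
  assumes "0 \<le> t"
  shows "integral {a * t..b * t} g = t * integral {a..b} (\<lambda>\<sigma>. g (t * \<sigma>))"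
proof (cases "t = 0")
  case False
  then have "(\<lambda>x. x / t) ` {a * t..b * t} = {a..b}"
    using assms by (simp add: image_divide_atLeastAtMost)
  then show ?thesis
    using integral_stretch_real[of t "a * t" "b * t" g] False assms by simp
qed simp

lemma continuous_on_integral_scaled:
  assumes k: "continuous_on (triangle T) (\<lambda>(t, s). k t s)" and y: "continuous_on {0..T} y"
    and ab: "0 \<le> a" "b \<le> 1"
  shows "continuous_on {0..T} (\<lambda>t. integral {a..b} (\<lambda>\<sigma>. k t (t * \<sigma>) * (\<sigma> ^ m * y (t * \<sigma>))))"
proof -
  have mem: "t * \<sigma> \<in> {0..T}" "t * \<sigma> \<le> t" if "t \<in> {0..T}" "\<sigma> \<in> {a..b}" for t \<sigma>
    using scaled_mem[of \<sigma> t T] mult_right_mono[of \<sigma> 1 t] that ab by (auto simp: mult.commute)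
  have "continuous_on ({0..T} \<times> {a..b}) (\<lambda>p. k (fst p) (fst p * snd p))"
    by (rule continuous_on_compose_pair[OF k]) (use mem in \<open>auto simp: triangle_def intro!: continuous_intros\<close>)
  moreover have "continuous_on ({0..T} \<times> {a..b}) (\<lambda>p. y (fst p * snd p))"
    using mem by (intro continuous_on_compose2[OF y]) (auto intro!: continuous_intros)
  ultimately have "continuous_on ({0..T} \<times> cbox a b)
      (\<lambda>(t, \<sigma>). k t (t * \<sigma>) * (\<sigma> ^ m * y (t * \<sigma>)))"
    unfolding case_prod_unfold cbox_interval by (intro continuous_intros)
  then show ?thesis
    using integral_continuous_on_param by fastforce
qed

section \<open>Behaviour at the origin and exponential bounds\<close>

lemma continuous_on_extend_at_0:
  fixes x :: "real \<Rightarrow> real"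
  assumes "0 < T" and x: "continuous_on {0<..T} x" and l: "(x \<longlongrightarrow> l) (at_right 0)"
  shows "continuous_on {0..T} (\<lambda>t. if t = 0 then l else x t)"
proof -
  define y where "y t = (if t = 0 then l else x t)" for t
  have "continuous (at t within {0..T}) y" if t: "t \<in> {0..T}" for t
  proof (cases "t = 0")
    case True
    have "(y \<longlongrightarrow> l) (at_right 0)"
      by (rule Lim_transform_eventually[OF l]) (auto simp: y_def eventually_at_filter)
    then show ?thesis
      using True assms(1) by (simp add: continuous_within at_within_Icc_at_right y_def)
  next
    case False
    have "at t within {0..T} = at t within {0<..T}"
      by (rule at_within_nhd[of t "{0<..}"]) (use t False in auto)
    moreover have "continuous_on {0<..T} y"
      using x by (rule continuous_on_eq) (simp add: y_def)
    ultimately show ?thesis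
      using t False by (simp add: continuous_on_eq_continuous_within)
  qed
  then show ?thesis
    unfolding y_def[symmetric] by (simp add: continuous_on_eq_continuous_within)
qed

lemma continuous_on_tendsto_at_right_0:
  fixes u :: "real \<Rightarrow> real"
  assumes "0 < T" "continuous_on {0..T} u"
  shows "(u \<longlongrightarrow> u 0) (at_right 0)"
  using continuous_on_Icc_at_rightD[of 0 T u] assms by simp

lemma continuous_on_Icc_eq_at_0:
  fixes u w :: "real \<Rightarrow> real"
  assumes "0 < T" "continuous_on {0..T} u" "continuous_on {0..T} w"
    and "\<And>t. t \<in> {0<..T} \<Longrightarrow> u t = w t"
  shows "u 0 = w 0"
proof (rule tendsto_unique)
  show "(u \<longlongrightarrow> u 0) (at_right 0)"
    using assms by (simp add: continuous_on_tendsto_at_right_0)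
  have "\<forall>\<^sub>F t in at_right 0. w t = u t"
    using eventually_at_right_less[of 0] eventually_at_right_real[OF assms(1)]
    by eventually_elim (use assms(4) in auto)
  then show "(u \<longlongrightarrow> w 0) (at_right 0)"
    using continuous_on_tendsto_at_right_0[OF assms(1,3)] by (rule Lim_transform_eventually[rotated])
qed simp

lemma compact_triangle: "compact (triangle T)"
proof -
  have "triangle T = ({0..T} \<times> {0..T}) \<inter> {p. snd p \<le> fst p}"
    by (auto simp: triangle_def)
  then show ?thesis
    by (simp add: compact_Int_closed compact_Times closed_Collect_le continuous_on_fst continuous_on_snd)
qed

text \<open>
  Integration gains the factor \<open>1/\<rho>\<close> against the weight \<open>exp (\<rho> s)\<close>.  This gain is what makes the
  integral term small after reweighting.
\<close>

lemma abs_integral_le_exp: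
  fixes g :: "real \<Rightarrow> real"
  assumes "g integrable_on {a..b}" "a \<le> b" "b \<le> t" "0 < \<rho>" "0 \<le> c"
    and g: "\<And>s. s \<in> {a..b} \<Longrightarrow> \<bar>g s\<bar> \<le> c * exp (\<rho> * s)"
  shows "\<bar>integral {a..b} g\<bar> \<le> c / \<rho> * exp (\<rho> * t)"
proof -
  have "((\<lambda>s. c * exp (\<rho> * s)) has_integral c / \<rho> * exp (\<rho> * b) - c / \<rho> * exp (\<rho> * a)) {a..b}"
    using assms(4)
    by (intro fundamental_theorem_of_calculus[OF assms(2)])
      (auto simp: has_real_derivative_iff_has_vector_derivative[symmetric]
        intro!: derivative_eq_intros)
  then have "\<bar>integral {a..b} g\<bar> \<le> c / \<rho> * exp (\<rho> * b) - c / \<rho> * exp (\<rho> * a)"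
    using integral_norm_bound_integral[OF assms(1), of "\<lambda>s. c * exp (\<rho> * s)"] g
    by (auto simp: has_integral_iff)
  also have "\<dots> \<le> c / \<rho> * exp (\<rho> * b)"
    using assms(4,5) by simp
  also have "\<dots> \<le> c / \<rho> * exp (\<rho> * t)"
    using assms(3-5) by (intro mult_left_mono) auto
  finally show ?thesis .
qed

section \<open>The Volterra operator with piecewise kernel\<close>

locale volterra_system =
  fixes T :: real and n N :: nat and \<alpha> :: "nat \<Rightarrow> real"
    and K K' :: "nat \<Rightarrow> real \<Rightarrow> real \<Rightarrow> real"
  assumes T: "0 < T" and n: "1 \<le> n"
    and \<alpha>0: "\<alpha> 0 = 0" and \<alpha>n: "\<alpha> n = 1" and \<alpha>_step: "\<forall>i<n. \<alpha> i < \<alpha> (Suc i)"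
    and kernel: "i \<in> {1..n} \<Longrightarrow> C1_kernel T (K i) (K' i)"
    and A: "condition_A n \<alpha> K T N"
begin

abbreviation "\<C> \<equiv> mspace (C_closed T)"
abbreviation "L \<equiv> L\<^sub>0 n \<alpha> K T N"
abbreviation "L_inv \<equiv> L\<^sub>0_inv n \<alpha> K T N"
abbreviation "V \<equiv> V_op n \<alpha> K K' T N"

definition volterra :: "(real \<Rightarrow> real) \<Rightarrow> real \<Rightarrow> real" where
  "volterra z t = (\<Sum>i=1..n. integral {\<alpha> (i - 1) * t..\<alpha> i * t} (\<lambda>s. K i t s * z s))"

definition volterra_deriv :: "(real \<Rightarrow> real) \<Rightarrow> real \<Rightarrow> real" where
  "volterra_deriv z t =
     (\<Sum>i=1..n. \<alpha> i * (K i t (\<alpha> i * t) * z (\<alpha> i * t))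
        - \<alpha> (i - 1) * (K i t (\<alpha> (i - 1) * t) * z (\<alpha> (i - 1) * t))
        + integral {\<alpha> (i - 1) * t..\<alpha> i * t} (\<lambda>s. K' i t s * z s))"

lemma K_continuous: "i \<in> {1..n} \<Longrightarrow> continuous_on (triangle T) (\<lambda>(t, s). K i t s)"
  and K'_continuous: "i \<in> {1..n} \<Longrightarrow> continuous_on (triangle T) (\<lambda>(t, s). K' i t s)"
  using kernel by (auto simp: C1_kernel_def)

lemma \<alpha>_mono: "i \<le> j \<Longrightarrow> j \<le> n \<Longrightarrow> \<alpha> i \<le> \<alpha> j"
proof (induction j rule: dec_induct)
  case (step m)
  then show ?case using \<alpha>_step[rule_format, of m] by simp
qed simp

lemmas \<alpha>_bounds = alpha_bounds[OF \<alpha>0 \<alpha>n \<alpha>_step]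

lemma \<alpha>_scaled:
  assumes "i \<le> n" "t \<in> {0..T}"
  shows "\<alpha> i * t \<in> {0..T}" "\<alpha> i * t \<le> t"
  using scaled_mem[OF \<alpha>_bounds[OF assms(1)] assms(2)]
    mult_right_mono[OF \<alpha>_bounds(2)[OF assms(1)], of t] assms(2) by auto

lemma Kn_nonzero: "t \<in> {0..T} \<Longrightarrow> K n t t \<noteq> 0"
  using A by (auto simp: condition_A_def)

lemma K_diagonals_continuous:
  assumes "i \<in> {1..n}" "j \<le> n"
  shows "continuous_on {0..T} (\<lambda>t. K i t (\<alpha> j * t))"
  by (rule continuous_on_compose_pair[OF K_continuous[OF assms(1)]])
    (use \<alpha>_scaled[OF assms(2)] in \<open>auto simp: triangle_def intro!: continuous_intros\<close>)

lemma Kn_continuous: "continuous_on {0..T} (\<lambda>t. K n t t)"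
  using K_diagonals_continuous[of n n] n \<alpha>n by simp

lemma continuous_scaled:
  "continuous_on {0..T} z \<Longrightarrow> j \<le> n \<Longrightarrow> continuous_on {0..T} (\<lambda>t. z (\<alpha> j * t))"
  by (rule continuous_on_compose2[of "{0..T}" z])
    (use \<alpha>_scaled(1) in \<open>auto intro!: continuous_on_mult_left continuous_on_id\<close>)

text \<open>
  Only interior points of the sectors matter below: the finitely many boundary points, where the
  selected index may differ, do not influence integrals.
\<close>

lemma piecewise_kernel_eq:
  assumes "0 < t" "i \<in> {1..n}" "\<alpha> (i - 1) * t < s" "s < \<alpha> i * t"
  shows "piecewise_kernel n \<alpha> K t s = K i t s"
proof -
  have "(THE i. i \<in> {1..n} \<and> \<alpha> (i - 1) * t \<le> s \<and> s < \<alpha> i * t) = i"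
  proof (rule the_equality)
    fix j assume j: "j \<in> {1..n} \<and> \<alpha> (j - 1) * t \<le> s \<and> s < \<alpha> j * t"
    have *: "\<alpha> p * t \<le> \<alpha> (q - 1) * t" if "p < q" "q \<le> n" for p q
      using \<alpha>_mono[of p "q - 1"] that assms(1) by (intro mult_right_mono) auto
    show "j = i"
    proof (cases i j rule: linorder_cases)
      case less
      then have "\<alpha> i * t \<le> s"
        using *[of i j] j by simp
      then show ?thesis using assms(4) by simp
    next
      case greater
      then have "\<alpha> j * t \<le> \<alpha> (i - 1) * t"
        using *[of j i] assms(2) by simp
      then show ?thesis using j assms(3) by simp
    qed simp
  qed (use assms in auto)
  moreover have "\<alpha> i * t \<le> 1 * t"
    using assms(1,2) \<alpha>_bounds(2)[of i] by (intro mult_right_mono) auto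
  ultimately show ?thesis
    using assms(4) by (simp add: piecewise_kernel_def)
qed

lemma K_slice_integrable:
  assumes "continuous_on {0..T} z" "i \<in> {1..n}" "t \<in> {0..T}"
  shows "(\<lambda>s. K i t s * z s) integrable_on {\<alpha> (i - 1) * t..\<alpha> i * t}"
    and "(\<lambda>s. K' i t s * z s) integrable_on {\<alpha> (i - 1) * t..\<alpha> i * t}"
proof -
  have i: "i \<le> n" "i - 1 \<le> n"
    using assms(2) by auto
  have sub: "{\<alpha> (i - 1) * t..\<alpha> i * t} \<subseteq> {0..T}" "\<alpha> i * t \<le> t" "0 \<le> \<alpha> (i - 1) * t"
    using \<alpha>_scaled[OF i(1) assms(3)] \<alpha>_scaled[OF i(2) assms(3)] by auto
  have "continuous_on {\<alpha> (i - 1) * t..\<alpha> i * t} (k t)"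
    if "continuous_on (triangle T) (\<lambda>(t, s). k t s)" for k :: "real \<Rightarrow> real \<Rightarrow> real"
    by (rule continuous_on_compose_pair[OF that])
      (use sub assms(3) in \<open>auto simp: triangle_def intro!: continuous_intros\<close>)
  then show "(\<lambda>s. K i t s * z s) integrable_on {\<alpha> (i - 1) * t..\<alpha> i * t}"
    and "(\<lambda>s. K' i t s * z s) integrable_on {\<alpha> (i - 1) * t..\<alpha> i * t}"
    using K_continuous[OF assms(2)] K'_continuous[OF assms(2)] continuous_on_subset[OF assms(1) sub(1)]
    by (auto intro!: integrable_continuous_real continuous_intros)
qed

text \<open>
  The function \<open>y\<close> is allowed to have an arbitrary value at \<open>0\<close>, as functions of the class on \<open>(0,T]\<close>
  do; \<open>z\<close> is its continuous extension.
\<close>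

lemma has_integral_piecewise_kernel:
  assumes z: "continuous_on {0..T} z" and eq: "\<And>s. 0 < s \<Longrightarrow> s \<le> T \<Longrightarrow> y s = z s"
    and t: "t \<in> {0<..T}"
  shows "((\<lambda>s. piecewise_kernel n \<alpha> K t s * y s) has_integral volterra z t) {0..t}"
proof -
  have "((\<lambda>s. piecewise_kernel n \<alpha> K t s * y s) has_integral
      (\<Sum>i=1..j. integral {\<alpha> (i - 1) * t..\<alpha> i * t} (\<lambda>s. K i t s * z s))) {0..\<alpha> j * t}"
    if "j \<le> n" for j
    using that
  proof (induction j)
    case 0
    then show ?case by (simp add: \<alpha>0 has_integral_refl)
  next
    case (Suc j)
    let ?i = "Suc j"
    have i: "?i \<in> {1..n}" using Suc by simp
    have le: "0 \<le> \<alpha> j * t" "\<alpha> j * t \<le> \<alpha> ?i * t" "\<alpha> ?i * t \<le> T"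
      using \<alpha>_scaled[of j t] \<alpha>_scaled[of ?i t] \<alpha>_mono[of j ?i] Suc.prems t
      by (auto intro!: mult_right_mono)
    have "((\<lambda>s. K ?i t s * z s) has_integral
        integral {\<alpha> j * t..\<alpha> ?i * t} (\<lambda>s. K ?i t s * z s)) {\<alpha> j * t..\<alpha> ?i * t}"
      using K_slice_integrable(1)[OF z i, of t] t by (auto simp: integrable_integral)
    then have "((\<lambda>s. piecewise_kernel n \<alpha> K t s * y s) has_integral
        integral {\<alpha> j * t..\<alpha> ?i * t} (\<lambda>s. K ?i t s * z s)) {\<alpha> j * t..\<alpha> ?i * t}"
    proof (rule has_integral_spike_finite[rotated 2])
      fix s assume "s \<in> {\<alpha> j * t..\<alpha> ?i * t} - {\<alpha> j * t, \<alpha> ?i * t}"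
      then show "piecewise_kernel n \<alpha> K t s * y s = K ?i t s * z s"
        using piecewise_kernel_eq[of t ?i s] i t le eq[of s] by auto
    qed simp
    from has_integral_combine[OF le(1,2) Suc.IH this] Suc.prems show ?case
      by simp
  qed
  from this[of n] show ?thesis
    by (simp add: volterra_def \<alpha>n)
qed

lemma has_real_derivative_volterra:
  assumes "continuous_on {0..T} z" "t \<in> {0..T}"
  shows "(volterra z has_real_derivative volterra_deriv z t) (at t within {0..T})"
  unfolding volterra_def volterra_deriv_def
  by (intro DERIV_sum has_real_derivative_integral_C1_kernel kernel assms \<alpha>_bounds \<alpha>_mono) auto

lemma volterra_0 [simp]: "volterra z 0 = 0"
  by (simp add: volterra_def)

lemma volterra_add:
  assumes "continuous_on {0..T} y" "continuous_on {0..T} z" "t \<in> {0..T}"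
  shows "volterra (\<lambda>s. y s + z s) t = volterra y t + volterra z t"
  unfolding volterra_def sum.distrib[symmetric] distrib_left
  by (intro sum.cong refl Henstock_Kurzweil_Integration.integral_add K_slice_integrable assms)

lemma integral_scaled_slice_continuous:
  assumes "i \<in> {1..n}" "continuous_on {0..T} z"
  shows "continuous_on {0..T} (\<lambda>t. integral {\<alpha> (i - 1)..\<alpha> i} (\<lambda>\<sigma>. K' i t (t * \<sigma>) * (\<sigma> ^ m * z (t * \<sigma>))))"
  using assms by (intro continuous_on_integral_scaled K'_continuous \<alpha>_bounds) auto

lemma volterra_deriv_continuous:
  assumes z: "continuous_on {0..T} z"
  shows "continuous_on {0..T} (volterra_deriv z)"
proof -
  have "continuous_on {0..T} (\<lambda>t. \<Sum>i=1..n. \<alpha> i * (K i t (\<alpha> i * t) * z (\<alpha> i * t))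
        - \<alpha> (i - 1) * (K i t (\<alpha> (i - 1) * t) * z (\<alpha> (i - 1) * t))
        + t * integral {\<alpha> (i - 1)..\<alpha> i} (\<lambda>\<sigma>. K' i t (t * \<sigma>) * (\<sigma> ^ 0 * z (t * \<sigma>))))"
    by (intro continuous_intros K_diagonals_continuous continuous_scaled
        integral_scaled_slice_continuous z) auto
  then show ?thesis
    by (rule continuous_on_eq) (simp add: volterra_deriv_def integral_scaled_interval)
qed

text \<open>
  The scaled form absorbs the weight \<open>(s/t)\<^sup>N\<close> and reproduces the value \<open>0\<close> at \<open>t = 0\<close>, so that
  continuity of \<open>V u\<close> on the closed interval needs no separate argument at the origin.
\<close>

lemma V_eq_scaled:
  assumes "t \<in> {0..T}"
  shows "V u t = t / K n t t * (\<Sum>i=1..n.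
     integral {\<alpha> (i - 1)..\<alpha> i} (\<lambda>\<sigma>. K' i t (t * \<sigma>) * (\<sigma> ^ N * u (t * \<sigma>))))"
proof (cases "t = 0")
  case False
  then have "V u t = (\<Sum>i=1..n. t * integral {\<alpha> (i - 1)..\<alpha> i}
      (\<lambda>\<sigma>. 1 / K n t t * (K' i t (t * \<sigma>) * (\<sigma> ^ N * u (t * \<sigma>)))))"
    using assms by (simp add: V_op_def integral_scaled_interval mult.assoc)
  then show ?thesis
    by (simp add: sum_distrib_left)
qed (use T in \<open>simp add: V_op_def\<close>)

lemma V_in_C:
  assumes "u \<in> \<C>"
  shows "V u \<in> \<C>"
proof -
  have u: "continuous_on {0..T} u"
    using assms by (simp add: mem_C_closed_iff)
  have "continuous_on {0..T} (\<lambda>t. t / K n t t * (\<Sum>i=1..n.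
     integral {\<alpha> (i - 1)..\<alpha> i} (\<lambda>\<sigma>. K' i t (t * \<sigma>) * (\<sigma> ^ N * u (t * \<sigma>)))))"
    using Kn_nonzero
    by (intro continuous_intros Kn_continuous integral_scaled_slice_continuous u) auto
  then have "continuous_on {0..T} (V u)"
    by (rule continuous_on_eq) (simp add: V_eq_scaled)
  moreover have "V u \<in> extensional {0..T}"
    by (simp add: V_op_def)
  ultimately show ?thesis
    by (simp only: mem_C_closed_iff)
qed

text \<open>
  This identity is the origin of \<open>L\<close> and \<open>V\<close>: in the derivative of the Volterra operator applied to
  \<open>s\<^sup>N u(s)\<close>, the boundary terms carry \<open>(\<alpha>\<^sub>i t)\<^sup>N\<close> and the integrand carries \<open>s\<^sup>N = t\<^sup>N (s/t)\<^sup>N\<close>; after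
  division by \<open>t\<^sup>N K\<^sub>n(t,t)\<close> the former give \<open>L u\<close> and the latter \<open>V u\<close>.
\<close>

lemma volterra_deriv_power_weight:
  assumes "t \<in> {0<..T}"
  shows "volterra_deriv (\<lambda>s. s ^ N * u s) t = t ^ N * K n t t * (L u t + V u t)"
proof -
  have t: "t \<in> {0..T}" "K n t t \<noteq> 0" "t > 0"
    using assms Kn_nonzero[of t] by auto
  have L: "K n t t * L u t = (\<Sum>i=1..n. \<alpha> i ^ (1 + N) * K i t (\<alpha> i * t) * u (\<alpha> i * t)
              - \<alpha> (i - 1) ^ (1 + N) * K i t (\<alpha> (i - 1) * t) * u (\<alpha> (i - 1) * t))"
    using t by (simp add: L\<^sub>0_def)
  have V: "K n t t * V u t = (\<Sum>i=1..n. integral {\<alpha> (i - 1) * t..\<alpha> i * t} (\<lambda>s. K' i t s * ((s / t) ^ N * u s)))"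
    using t by (simp add: V_eq_scaled integral_scaled_interval sum_distrib_left)
  have int: "t ^ N * integral S (\<lambda>s. K' i t s * ((s / t) ^ N * u s))
      = integral S (\<lambda>s. K' i t s * (s ^ N * u s))" for S i
    unfolding integral_mult_right[symmetric] using t
    by (intro Henstock_Kurzweil_Integration.integral_cong) (simp add: power_divide)
  have "t ^ N * K n t t * (L u t + V u t) = t ^ N * (K n t t * L u t + K n t t * V u t)"
    by (simp add: algebra_simps)
  also have "\<dots> = volterra_deriv (\<lambda>s. s ^ N * u s) t"
    unfolding L V sum.distrib[symmetric] sum_distrib_left volterra_deriv_def distrib_left int
    by (intro sum.cong refl) (simp add: power_mult_distrib algebra_simps)
  finally show ?thesis ..
qed

lemma K'_quotient_bounded:
  obtains B where "\<And>i t s. i \<in> {1..n} \<Longrightarrow> (t, s) \<in> triangle T \<Longrightarrow> \<bar>K' i t s / K n t t\<bar> \<le> B i"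
proof -
  have "\<exists>B. \<forall>t s. (t, s) \<in> triangle T \<longrightarrow> \<bar>K' i t s / K n t t\<bar> \<le> B" if "i \<in> {1..n}" for i
  proof -
    have "continuous_on (triangle T) (\<lambda>p. K n (fst p) (fst p))"
      by (rule continuous_on_compose2[OF Kn_continuous])
        (auto simp: triangle_def intro!: continuous_on_fst continuous_on_id)
    then have "continuous_on (triangle T) (\<lambda>p. K' i (fst p) (snd p) / K n (fst p) (fst p))"
      using K'_continuous[OF that] Kn_nonzero
      by (intro continuous_on_divide) (auto simp: case_prod_unfold triangle_def)
    then have "bounded ((\<lambda>p. K' i (fst p) (snd p) / K n (fst p) (fst p)) ` triangle T)"
      by (intro compact_imp_bounded compact_continuous_image compact_triangle)
    then obtain B where B: "\<forall>p\<in>triangle T. \<bar>K' i (fst p) (snd p) / K n (fst p) (fst p)\<bar> \<le> B"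
      unfolding bounded_iff ball_simps real_norm_def by blast
    have "\<bar>K' i t s / K n t t\<bar> \<le> B" if "(t, s) \<in> triangle T" for t s
      using bspec[OF B that] by simp
    then show ?thesis
      by blast
  qed
  then have "\<forall>i\<in>{1..n}. \<exists>B. \<forall>t s. (t, s) \<in> triangle T \<longrightarrow> \<bar>K' i t s / K n t t\<bar> \<le> B"
    by blast
  from bchoice[OF this] obtain B where
    "\<forall>i\<in>{1..n}. \<forall>t s. (t, s) \<in> triangle T \<longrightarrow> \<bar>K' i t s / K n t t\<bar> \<le> B i" ..
  then show ?thesis
    using that by blast
qed

text \<open>
  The constant \<open>c\<close> is independent of the weight \<open>\<rho>\<close>, hence \<open>V\<close> has arbitrarily small Lipschitz constant
  \<open>c/\<rho>\<close> with respect to the norm \<open>max \<bar>u(t)\<bar> exp (-\<rho> t)\<close>.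
\<close>

lemma V_bound:
  obtains c where "0 \<le> c"
    "\<And>u w M \<rho> t. u \<in> \<C> \<Longrightarrow> w \<in> \<C> \<Longrightarrow> 0 < \<rho> \<Longrightarrow>
       (\<And>s. s \<in> {0..T} \<Longrightarrow> \<bar>u s - w s\<bar> \<le> M * exp (\<rho> * s)) \<Longrightarrow>
       t \<in> {0..T} \<Longrightarrow> \<bar>V u t - V w t\<bar> \<le> c * M / \<rho> * exp (\<rho> * t)"
proof -
  obtain B where B: "\<And>i t s. i \<in> {1..n} \<Longrightarrow> (t, s) \<in> triangle T \<Longrightarrow> \<bar>K' i t s / K n t t\<bar> \<le> B i"
    using K'_quotient_bounded by blast
  have B0: "0 \<le> B i" if "i \<in> {1..n}" for i
    using order_trans[OF abs_ge_zero B[OF that, of 0 0]] T by (simp add: triangle_def)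
  have S0: "0 \<le> (\<Sum>i=1..n. B i)"
    by (intro sum_nonneg B0)
  have "\<bar>V u t - V w t\<bar> \<le> (\<Sum>i=1..n. B i) * M / \<rho> * exp (\<rho> * t)"
    if u: "u \<in> \<C>" and w: "w \<in> \<C>" and \<rho>: "0 < \<rho>"
      and M: "\<And>s. s \<in> {0..T} \<Longrightarrow> \<bar>u s - w s\<bar> \<le> M * exp (\<rho> * s)" and t: "t \<in> {0..T}"
    for u w M \<rho> t
  proof (cases "t = 0")
    case True
    have "0 \<le> M"
      using M[of 0] T by simp
    then have "0 \<le> (\<Sum>i=1..n. B i) * M / \<rho>"
      by (intro divide_nonneg_pos mult_nonneg_nonneg S0 \<rho>)
    then show ?thesis
      using True T by (simp add: V_eq_scaled)
  next
    case False
    let ?I = "\<lambda>i. {\<alpha> (i - 1) * t..\<alpha> i * t}"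
    let ?g = "\<lambda>i v s. K' i t s / K n t t * (s / t) ^ N * v s"
    have M0: "0 \<le> M"
      using M[of 0] T by simp
    have slice: "\<bar>integral (?I i) (?g i u) - integral (?I i) (?g i w)\<bar> \<le> B i * M / \<rho> * exp (\<rho> * t)"
      if i: "i \<in> {1..n}" for i
    proof -
      have i': "i \<le> n" "i - 1 \<le> n"
        using i by auto
      have I: "s \<in> {0..T}" "s \<le> t" if "s \<in> ?I i" for s
        using that \<alpha>_scaled[OF i'(1) t] \<alpha>_scaled[OF i'(2) t] t by auto
      have int: "?g i v integrable_on ?I i" if "v \<in> \<C>" for v
      proof -
        have "continuous_on {0..T} (\<lambda>s. 1 / K n t t * ((s / t) ^ N * v s))"
          using that False by (intro continuous_intros) (auto simp: mem_C_closed_iff)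
        from K_slice_integrable(2)[OF this i t] show ?thesis
          by (simp add: mult.assoc)
      qed
      have "integral (?I i) (?g i u) - integral (?I i) (?g i w) = integral (?I i) (\<lambda>s. ?g i u s - ?g i w s)"
        by (intro Henstock_Kurzweil_Integration.integral_diff[symmetric] int u w)
      also have "\<bar>\<dots>\<bar> \<le> B i * M / \<rho> * exp (\<rho> * t)"
      proof (rule abs_integral_le_exp[OF integrable_diff[OF int[OF u] int[OF w]]])
        show "\<alpha> (i - 1) * t \<le> \<alpha> i * t"
          using \<alpha>_mono[of "i - 1" i] i t by (intro mult_right_mono) auto
        show "\<alpha> i * t \<le> t"
          using \<alpha>_scaled[of i t] i t by simp
        fix s assume s: "s \<in> ?I i"
        have "\<bar>K' i t s / K n t t\<bar> \<le> B i"
          using B[OF i, of t s] I[OF s] t by (auto simp: triangle_def)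
        moreover have "\<bar>(s / t) ^ N\<bar> \<le> 1"
          using I[OF s] False t by (auto simp: power_abs intro!: power_le_one)
        ultimately have "\<bar>K' i t s / K n t t * (s / t) ^ N * (u s - w s)\<bar> \<le> B i * 1 * (M * exp (\<rho> * s))"
          unfolding abs_mult using M[OF I(1)[OF s]] B0[OF i]
          by (intro mult_mono) auto
        then show "\<bar>?g i u s - ?g i w s\<bar> \<le> B i * M * exp (\<rho> * s)"
          by (simp add: right_diff_distrib mult.assoc)
      qed (use \<rho> B0[OF i] M0 in auto)
      finally show ?thesis .
    qed
    have "\<bar>V u t - V w t\<bar> = \<bar>\<Sum>i=1..n. integral (?I i) (?g i u) - integral (?I i) (?g i w)\<bar>"
      using False t by (simp add: V_op_def sum_subtractf)
    also have "\<dots> \<le> (\<Sum>i=1..n. B i * M / \<rho> * exp (\<rho> * t))"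
      by (rule order_trans[OF sum_abs sum_mono[OF slice]])
    finally show ?thesis
      by (simp add: sum_distrib_right sum_divide_distrib)
  qed
  then show ?thesis
    using that[OF S0] by blast
qed

end

section \<open>Complete metric spaces\<close>

lemma complete_C_closed: "Metric_space.mcomplete (mspace (C_closed T)) (mdist (C_closed T))"
proof -
  have "Met_TC.mcomplete TYPE(real)"
    by (simp add: mcomplete_iff_complete complete_UNIV)
  then show ?thesis
    using Met_TC.mcomplete_cfunspace[where 'a = real, of "top_of_set {0..T}"]
    by (simp add: mcomplete_of_def Met_TC.Self_def euclidean_metric_def)
qed

lemma mdist_C_closed_le_iff:
  assumes "0 \<le> T" "u \<in> mspace (C_closed T)" "w \<in> mspace (C_closed T)"
  shows "mdist (C_closed T) u w \<le> B \<longleftrightarrow> (\<forall>t\<in>{0..T}. \<bar>u t - w t\<bar> \<le> B)"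
  using cfunspace_mdist_le[OF assms(2,3), of B] assms(1) by (simp add: dist_real_def)

text \<open>
  If an iterate of \<open>f\<close> contracts, its fixed point \<open>x\<close> is also fixed by \<open>f\<close>: the point \<open>f x\<close> is fixed by the
  same iterate, which has only one fixed point.  This allows weighted estimates to be used without
  introducing a second metric.
\<close>

lemma (in Metric_space) fixed_point_if_iterate_contracts:
  assumes "mcomplete" "M \<noteq> {}" "f \<in> M \<rightarrow> M" "k < 1"
    and con: "\<And>x y. x \<in> M \<Longrightarrow> y \<in> M \<Longrightarrow> d ((f ^^ m) x) ((f ^^ m) y) \<le> k * d x y"
  obtains x where "x \<in> M" "f x = x"
proof -
  have "(f ^^ j) x \<in> M" if "x \<in> M" for j x
    using assms(3) that by (induction j) auto
  then obtain x where x: "x \<in> M" "(f ^^ m) x = x"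
    using Banach_fixedpoint_thm[OF assms(1,2) _ assms(4), of "f ^^ m"] con by blast
  have fx: "f x \<in> M"
    using assms(3) x(1) by auto
  have "(f ^^ m) (f x) = f x"
    using x(2) by (metis funpow_swap1)
  then have "(1 - k) * d (f x) x \<le> 0"
    using con[OF fx x(1)] x(2) by (simp add: algebra_simps)
  then have "d (f x) x \<le> 0"
    using assms(4) by (simp add: mult_le_0_iff)
  then show ?thesis
    using that x(1) fx nonneg[of "f x" x] zero[of "f x" x] by simp
qed

section \<open>Contraction in an exponentially weighted norm\<close>

context volterra_system
begin

lemma L_diff:
  assumes "t \<in> {0..T}" and "\<And>s. s \<in> {0..T} \<Longrightarrow> u s = b s - a s"
  shows "L u t = L b t - L a t"
proof -
  have u: "u (\<alpha> i * t) = b (\<alpha> i * t) - a (\<alpha> i * t)" if "i \<le> n" for i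
    using assms(2) \<alpha>_scaled(1)[OF that assms(1)] .
  have "(\<Sum>i=1..n. \<alpha> i ^ (1 + N) * K i t (\<alpha> i * t) * u (\<alpha> i * t)
              - \<alpha> (i - 1) ^ (1 + N) * K i t (\<alpha> (i - 1) * t) * u (\<alpha> (i - 1) * t))
    = (\<Sum>i=1..n. \<alpha> i ^ (1 + N) * K i t (\<alpha> i * t) * b (\<alpha> i * t)
              - \<alpha> (i - 1) ^ (1 + N) * K i t (\<alpha> (i - 1) * t) * b (\<alpha> (i - 1) * t))
    - (\<Sum>i=1..n. \<alpha> i ^ (1 + N) * K i t (\<alpha> i * t) * a (\<alpha> i * t)
              - \<alpha> (i - 1) ^ (1 + N) * K i t (\<alpha> (i - 1) * t) * a (\<alpha> (i - 1) * t))"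
    unfolding sum_subtractf[symmetric]
  proof (rule sum.cong[OF refl])
    fix i assume "i \<in> {1..n}"
    then have "i \<le> n" "i - 1 \<le> n" by auto
    then show "\<alpha> i ^ (1 + N) * K i t (\<alpha> i * t) * u (\<alpha> i * t)
        - \<alpha> (i - 1) ^ (1 + N) * K i t (\<alpha> (i - 1) * t) * u (\<alpha> (i - 1) * t)
      = \<alpha> i ^ (1 + N) * K i t (\<alpha> i * t) * b (\<alpha> i * t)
        - \<alpha> (i - 1) ^ (1 + N) * K i t (\<alpha> (i - 1) * t) * b (\<alpha> (i - 1) * t)
        - (\<alpha> i ^ (1 + N) * K i t (\<alpha> i * t) * a (\<alpha> i * t)
        - \<alpha> (i - 1) ^ (1 + N) * K i t (\<alpha> (i - 1) * t) * a (\<alpha> (i - 1) * t))"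
      by (simp only: u right_diff_distrib)
  qed
  then show ?thesis
    using assms(1) by (simp add: L\<^sub>0_def diff_divide_distrib)
qed

text \<open>
  The operator \<open>L\<close> looks only at the points \<open>\<alpha>\<^sub>i t \<le> t\<close>, so the bound needs \<open>u - w\<close> on \<open>[0,t]\<close> alone.  It
  is obtained from the estimate on the whole interval by shortening this interval to \<open>[0,t]\<close>.  Such
  causality is what makes the estimate compatible with increasing weights.
\<close>

lemma L_near_identity:
  obtains q where "q < 1"
    "\<And>u w t M. t \<in> {0..T} \<Longrightarrow> (\<And>s. s \<in> {0..t} \<Longrightarrow> \<bar>u s - w s\<bar> \<le> M) \<Longrightarrow>
       \<bar>(L u t - u t) - (L w t - w t)\<bar> \<le> q * M"
proof -
  obtain q where q: "q < 1" "\<And>t. t \<in> {0..T} \<Longrightarrow> inverse \<bar>K n t t\<bar> *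
          (\<Sum>i=1..n. \<alpha> i ^ (1 + N) * \<bar>K i t (\<alpha> i * t)\<bar>
                   + \<alpha> (i - 1) ^ (1 + N) * \<bar>K i t (\<alpha> (i - 1) * t)\<bar>) \<le> 1 + q"
    using A unfolding condition_A_def by blast
  have "\<bar>(L u t - u t) - (L w t - w t)\<bar> \<le> q * M"
    if t: "t \<in> {0..T}" and M: "\<And>s. s \<in> {0..t} \<Longrightarrow> \<bar>u s - w s\<bar> \<le> M" for u w t M
  proof -
    have "L\<^sub>0 n \<alpha> K t N v t = L v t" for v
      using t by (simp add: L\<^sub>0_def)
    then show ?thesis
      using L0_near_identity[of n \<alpha> K t t N q u w M, OF n \<alpha>0 \<alpha>n \<alpha>_step Kn_nonzero[OF t] _ q(2)[OF t] M] t
      by simp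
  qed
  with q(1) that show ?thesis by blast
qed

text \<open>
  The bound of the inverse of \<open>L\<close> is the same \<open>1/(1 - q)\<close> in every weighted norm: at a point \<open>r\<close> where
  \<open>\<bar>a - b\<bar> exp (-\<rho> s)\<close> is maximal, with maximum \<open>m\<close>, the unweighted difference on \<open>[0,r]\<close> is at most
  \<open>m exp (\<rho> r)\<close>, because the weight increases; nearness to the identity then gives \<open>m \<le> D + q m\<close>.
\<close>

lemma L_inverse_exp_bound:
  obtains q where "q < 1"
    "\<And>a b D \<rho> t. a \<in> \<C> \<Longrightarrow> b \<in> \<C> \<Longrightarrow> 0 < \<rho> \<Longrightarrow>
       (\<And>s. s \<in> {0..T} \<Longrightarrow> \<bar>L a s - L b s\<bar> \<le> D * exp (\<rho> * s)) \<Longrightarrow>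
       t \<in> {0..T} \<Longrightarrow> \<bar>a t - b t\<bar> \<le> D / (1 - q) * exp (\<rho> * t)"
proof -
  obtain q where q: "q < 1" and near: "\<And>u w t M. t \<in> {0..T} \<Longrightarrow>
       (\<And>s. s \<in> {0..t} \<Longrightarrow> \<bar>u s - w s\<bar> \<le> M) \<Longrightarrow> \<bar>(L u t - u t) - (L w t - w t)\<bar> \<le> q * M"
    using L_near_identity by blast
  have "\<bar>a t - b t\<bar> \<le> D / (1 - q) * exp (\<rho> * t)"
    if ab: "a \<in> \<C>" "b \<in> \<C>" and \<rho>: "0 < \<rho>"
      and D: "\<And>s. s \<in> {0..T} \<Longrightarrow> \<bar>L a s - L b s\<bar> \<le> D * exp (\<rho> * s)" and t: "t \<in> {0..T}"
    for a b D \<rho> t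
  proof -
    define m where "m s = \<bar>a s - b s\<bar> * exp (- (\<rho> * s))" for s
    have m: "\<bar>a s - b s\<bar> = m s * exp (\<rho> * s)" for s
      by (simp add: m_def exp_minus)
    have "continuous_on {0..T} m"
      using ab unfolding m_def mem_C_closed_iff by (intro continuous_intros) auto
    then obtain r where r: "r \<in> {0..T}" "\<And>s. s \<in> {0..T} \<Longrightarrow> m s \<le> m r"
      using continuous_attains_sup[of "{0..T}" m] T by auto
    have "\<bar>a s - b s\<bar> \<le> m r * exp (\<rho> * r)" if "s \<in> {0..r}" for s
      unfolding m using that r \<rho> by (intro mult_mono) (auto simp: m_def)
    then have "\<bar>(L a r - a r) - (L b r - b r)\<bar> \<le> q * (m r * exp (\<rho> * r))"
      by (rule near[OF r(1)])
    then have "m r * exp (\<rho> * r) \<le> D * exp (\<rho> * r) + q * (m r * exp (\<rho> * r))"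
      using D[OF r(1)] unfolding m[symmetric] by linarith
    then have "m r * exp (\<rho> * r) \<le> (D + q * m r) * exp (\<rho> * r)"
      by (simp add: algebra_simps)
    then have "m r \<le> D + q * m r"
      by simp
    then have "m r \<le> D / (1 - q)"
      using q by (simp add: field_simps)
    then show ?thesis
      unfolding m using r(2)[OF t] by (intro mult_right_mono) auto
  qed
  with q that show ?thesis by blast
qed

lemma L_bij: "bij_betw L \<C> \<C>"
  using L0_bounded_inverse(1)[of T n \<alpha> K N] T n \<alpha>0 \<alpha>n \<alpha>_step K_continuous A by blast

lemma L_inv_in_C: "v \<in> \<C> \<Longrightarrow> L_inv v \<in> \<C>"
  and L_L_inv: "v \<in> \<C> \<Longrightarrow> L (L_inv v) = v"
  unfolding L\<^sub>0_inv_def using L_bij by (auto simp only: bij_betw_def inv_into_into f_inv_into_f)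

lemma C_eqI:
  assumes "u \<in> \<C>" "w \<in> \<C>" "\<And>t. t \<in> {0..T} \<Longrightarrow> u t = w t"
  shows "u = w"
  using assms unfolding mem_C_closed_iff by (meson extensionalityI)

definition step :: "(real \<Rightarrow> real) \<Rightarrow> (real \<Rightarrow> real) \<Rightarrow> real \<Rightarrow> real" where
  "step h u = (\<lambda>t\<in>{0..T}. A_op n \<alpha> K K' T N u t + L_inv h t)"

lemma step_in_C:
  assumes "h \<in> \<C>" "u \<in> \<C>"
  shows "step h u \<in> \<C>"
proof -
  have "continuous_on {0..T} (\<lambda>t. - L_inv (V u) t + L_inv h t)"
    using L_inv_in_C[OF assms(1)] L_inv_in_C[OF V_in_C[OF assms(2)]]
    unfolding mem_C_closed_iff by (intro continuous_intros) auto
  then have "(\<lambda>t\<in>{0..T}. - L_inv (V u) t + L_inv h t) \<in> \<C>"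
    by (rule restrict_mem_C_closed)
  also have "(\<lambda>t\<in>{0..T}. - L_inv (V u) t + L_inv h t) = step h u"
    by (auto simp: step_def A_op_def)
  finally show ?thesis .
qed

lemma L_step:
  assumes "h \<in> \<C>" "u \<in> \<C>" "t \<in> {0..T}"
  shows "L (step h u) t = h t - V u t"
  using L_diff[OF assms(3), of "step h u" "L_inv h" "L_inv (V u)"]
  by (simp add: step_def A_op_def L_L_inv V_in_C assms del: mspace_cfunspace)

lemma step_fixed_point_iff:
  assumes "h \<in> \<C>" "u \<in> \<C>"
  shows "step h u = u \<longleftrightarrow> (\<forall>t\<in>{0..T}. L u t + V u t = h t)"
proof
  assume "step h u = u"
  then show "\<forall>t\<in>{0..T}. L u t + V u t = h t"
    using L_step[OF assms] by auto
next
  assume eq: "\<forall>t\<in>{0..T}. L u t + V u t = h t"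
  have "L (step h u) = L u"
  proof (rule C_eqI)
    show "L (step h u) t = L u t" if "t \<in> {0..T}" for t
      using L_step[OF assms that] bspec[OF eq that] by linarith
  qed (intro bij_betwE[OF L_bij, rule_format] step_in_C assms)+
  then show "step h u = u"
    using L_bij step_in_C assms by (auto simp only: bij_betw_def inj_on_def)
qed

text \<open>
  In the weighted norm, \<open>A = -L\<^sup>-\<^sup>1 V\<close> has Lipschitz constant at most \<open>c / (\<rho> (1 - q))\<close>.  The chosen \<open>\<rho>\<close>
  makes it at most \<open>c / (2 (c + 1))\<close>, where \<open>c + 1\<close> avoids a division by zero.
\<close>

lemma step_contracts:
  obtains \<rho> where "0 < \<rho>"
    "\<And>h u w M t. h \<in> \<C> \<Longrightarrow> u \<in> \<C> \<Longrightarrow> w \<in> \<C> \<Longrightarrow>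
       (\<And>s. s \<in> {0..T} \<Longrightarrow> \<bar>u s - w s\<bar> \<le> M * exp (\<rho> * s)) \<Longrightarrow>
       t \<in> {0..T} \<Longrightarrow> \<bar>step h u t - step h w t\<bar> \<le> M / 2 * exp (\<rho> * t)"
proof -
  obtain q where q: "q < 1" and L: "\<And>a b D \<rho> t. a \<in> \<C> \<Longrightarrow> b \<in> \<C> \<Longrightarrow> 0 < \<rho> \<Longrightarrow>
       (\<And>s. s \<in> {0..T} \<Longrightarrow> \<bar>L a s - L b s\<bar> \<le> D * exp (\<rho> * s)) \<Longrightarrow>
       t \<in> {0..T} \<Longrightarrow> \<bar>a t - b t\<bar> \<le> D / (1 - q) * exp (\<rho> * t)"
    using L_inverse_exp_bound by blast
  obtain c where c: "0 \<le> c" and V: "\<And>u w M \<rho> t. u \<in> \<C> \<Longrightarrow> w \<in> \<C> \<Longrightarrow> 0 < \<rho> \<Longrightarrow>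
       (\<And>s. s \<in> {0..T} \<Longrightarrow> \<bar>u s - w s\<bar> \<le> M * exp (\<rho> * s)) \<Longrightarrow>
       t \<in> {0..T} \<Longrightarrow> \<bar>V u t - V w t\<bar> \<le> c * M / \<rho> * exp (\<rho> * t)"
    using V_bound by blast
  define \<rho> where "\<rho> = 2 * (c + 1) / (1 - q)"
  have \<rho>: "0 < \<rho>"
    using q c by (simp add: \<rho>_def)
  have "\<bar>step h u t - step h w t\<bar> \<le> M / 2 * exp (\<rho> * t)"
    if h: "h \<in> \<C>" and uw: "u \<in> \<C>" "w \<in> \<C>"
      and M: "\<And>s. s \<in> {0..T} \<Longrightarrow> \<bar>u s - w s\<bar> \<le> M * exp (\<rho> * s)" and t: "t \<in> {0..T}"
    for h u w M t
  proof -
    have M0: "0 \<le> M"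
      using M[of 0] T by simp
    have "\<bar>step h u t - step h w t\<bar> \<le> c * M / \<rho> / (1 - q) * exp (\<rho> * t)"
    proof (rule L[OF step_in_C[OF h uw(1)] step_in_C[OF h uw(2)] \<rho> _ t])
      fix s assume s: "s \<in> {0..T}"
      have "\<bar>V u s - V w s\<bar> \<le> c * M / \<rho> * exp (\<rho> * s)"
        using V[OF uw \<rho> M s] .
      then show "\<bar>L (step h u) s - L (step h w) s\<bar> \<le> c * M / \<rho> * exp (\<rho> * s)"
        unfolding L_step[OF h uw(1) s] L_step[OF h uw(2) s] by simp
    qed
    also have "c * M / \<rho> / (1 - q) = M / 2 * (c / (c + 1))"
    proof -
      have "c * M / (2 * (c + 1) / e) / e = M / 2 * (c / (c + 1))" if "e \<noteq> 0" for e
        using c that by (simp add: divide_simps)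
      then show ?thesis
        using q unfolding \<rho>_def by simp
    qed
    also have "\<dots> * exp (\<rho> * t) \<le> M / 2 * 1 * exp (\<rho> * t)"
      using c M0 by (intro mult_right_mono mult_left_mono) (auto simp: field_simps)
    finally show ?thesis
      by simp
  qed
  with \<rho> that show ?thesis by blast
qed

text \<open>
  On \<open>[0,T]\<close> the weight lies between \<open>1\<close> and \<open>exp (\<rho> T)\<close>, so in the maximum norm the iterates satisfy
  a Lipschitz condition with constant \<open>exp (\<rho> T) / 2\<^sup>m\<close>.  A large iterate therefore contracts, and the
  same estimate gives the convergence from every initial approximation.
\<close>

lemma successive_approximations:
  assumes h: "h \<in> \<C>"
  obtains u where "u \<in> \<C>" "step h u = u" "\<And>w. w \<in> \<C> \<Longrightarrow> step h w = w \<Longrightarrow> w = u"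
    "\<And>U. U 0 \<in> \<C> \<Longrightarrow> (\<And>m. U (Suc m) = step h (U m)) \<Longrightarrow>
       limitin (mtopology_of (C_closed T)) U u sequentially"
proof -
  let ?d = "mdist (C_closed T)"
  interpret M: Metric_space \<C> ?d
    by (rule Metric_space_mspace_mdist)
  obtain \<rho> where \<rho>: "0 < \<rho>" and con: "\<And>h u w M t. h \<in> \<C> \<Longrightarrow> u \<in> \<C> \<Longrightarrow> w \<in> \<C> \<Longrightarrow>
       (\<And>s. s \<in> {0..T} \<Longrightarrow> \<bar>u s - w s\<bar> \<le> M * exp (\<rho> * s)) \<Longrightarrow>
       t \<in> {0..T} \<Longrightarrow> \<bar>step h u t - step h w t\<bar> \<le> M / 2 * exp (\<rho> * t)"
    using step_contracts by blast
  have iter_C: "(step h ^^ m) u \<in> \<C>" if "u \<in> \<C>" for m u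
    using that by (induction m) (auto simp only: funpow.simps id_apply comp_apply step_in_C[OF h])
  have iter: "\<bar>(step h ^^ m) u t - (step h ^^ m) w t\<bar> \<le> ?d u w / 2 ^ m * exp (\<rho> * t)"
    if uw: "u \<in> \<C>" "w \<in> \<C>" and t: "t \<in> {0..T}" for m u w t
    using t
  proof (induction m arbitrary: t)
    case 0
    have "\<bar>u t - w t\<bar> \<le> ?d u w"
      using mdist_C_closed_le_iff[OF _ uw, of "?d u w"] T 0 by auto
    also have "?d u w * 1 \<le> ?d u w * exp (\<rho> * t)"
      using \<rho> 0 by (intro mult_left_mono) auto
    finally show ?case by simp
  next
    case (Suc m)
    from con[OF h iter_C[OF uw(1)] iter_C[OF uw(2)] Suc.IH Suc.prems] show ?case
      by (simp add: mult.commute)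
  qed
  have iter_dist: "?d ((step h ^^ m) u) ((step h ^^ m) w) \<le> exp (\<rho> * T) / 2 ^ m * ?d u w"
    if uw: "u \<in> \<C>" "w \<in> \<C>" for m u w
  proof -
    have "\<bar>(step h ^^ m) u t - (step h ^^ m) w t\<bar> \<le> exp (\<rho> * T) / 2 ^ m * ?d u w" if t: "t \<in> {0..T}" for t
    proof -
      have "?d u w / 2 ^ m * exp (\<rho> * t) \<le> ?d u w / 2 ^ m * exp (\<rho> * T)"
        using t \<rho> by (intro mult_left_mono) auto
      then show ?thesis
        using iter[OF uw t, of m] by (simp add: mult.commute)
    qed
    then show ?thesis
      using mdist_C_closed_le_iff[OF _ iter_C[OF uw(1)] iter_C[OF uw(2)]] T by simp
  qed
  have lim: "(\<lambda>m. exp (\<rho> * T) / 2 ^ m) \<longlonglongrightarrow> 0"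
    by (rule LIMSEQ_divide_realpow_zero) simp
  then have "\<forall>\<^sub>F m in sequentially. exp (\<rho> * T) / 2 ^ m < 1"
    by (rule order_tendstoD) simp
  then obtain m where m: "exp (\<rho> * T) / 2 ^ m < 1"
    by (auto simp: eventually_sequentially)
  have C: "\<C> \<noteq> {}" "step h \<in> \<C> \<rightarrow> \<C>"
    using h step_in_C[OF h] by (fast, fast)
  obtain u where u: "u \<in> \<C>" "step h u = u"
    by (rule M.fixed_point_if_iterate_contracts[OF complete_C_closed C m iter_dist])
  have fixed: "(step h ^^ m) w = w" if "step h w = w" for m w
    by (induction m) (simp_all add: that)
  have "w = u" if w: "w \<in> \<C>" "step h w = w" for w
  proof -
    have "(1 - exp (\<rho> * T) / 2 ^ m) * ?d w u \<le> 0"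
      using iter_dist[OF w(1) u(1), of m] fixed[OF w(2)] fixed[OF u(2)]
      by (simp add: algebra_simps)
    then have "?d w u \<le> 0"
      using m by (simp add: mult_le_0_iff)
    then show ?thesis
      using M.nonneg[of w u] M.zero[OF w(1) u(1)] by simp
  qed
  moreover
  have "limitin M.mtopology U u sequentially"
    if U: "U 0 \<in> \<C>" "\<And>m. U (Suc m) = step h (U m)" for U
  proof -
    have Um: "U m = (step h ^^ m) (U 0)" for m
      by (induction m) (simp_all add: U(2))
    have bound_lim: "(\<lambda>m. exp (\<rho> * T) / 2 ^ m * ?d (U 0) u) \<longlonglongrightarrow> 0"
      using tendsto_mult_left_zero[OF lim] .
    have "?d (U m) u \<le> exp (\<rho> * T) / 2 ^ m * ?d (U 0) u" for m
      using iter_dist[OF U(1) u(1), of m] unfolding fixed[OF u(2)] Um[symmetric] .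
    then have "(\<lambda>m. ?d (U m) u) \<longlonglongrightarrow> 0"
      by (intro Lim_null_comparison[OF _ bound_lim] always_eventually allI)
        (simp only: real_norm_def abs_of_nonneg[OF M.nonneg])
    moreover have "U m \<in> \<C>" for m
      by (subst Um) (rule iter_C[OF U(1)])
    ultimately show ?thesis
      unfolding M.limitin_metric_dist_null using u(1) by auto
  qed
  ultimately show ?thesis
    using that[OF u] unfolding mtopology_of_def by blast
qed

text \<open>
  At \<open>t = 0\<close> all points \<open>\<alpha>\<^sub>i t\<close> coincide, so \<open>L u (0)\<close> is a multiple of \<open>u(0)\<close>; the multiplier is within
  \<open>q < 1\<close> of \<open>1\<close>, hence nonzero.
\<close>

lemma zero_at_0_if_homogeneous_at_0:
  assumes "L u 0 + V u 0 = 0"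
  shows "u 0 = 0"
proof -
  obtain q where q: "q < 1" and near: "\<And>u w t M. t \<in> {0..T} \<Longrightarrow>
       (\<And>s. s \<in> {0..t} \<Longrightarrow> \<bar>u s - w s\<bar> \<le> M) \<Longrightarrow> \<bar>(L u t - u t) - (L w t - w t)\<bar> \<le> q * M"
    using L_near_identity by blast
  have "L u 0 = 0" "L (\<lambda>_. 0) 0 = 0"
    using assms T by (simp_all add: V_eq_scaled L\<^sub>0_def)
  then have "\<bar>u 0\<bar> \<le> q * \<bar>u 0\<bar>"
    using near[of 0 u "\<lambda>_. 0" "\<bar>u 0\<bar>"] T by simp
  then have "(1 - q) * \<bar>u 0\<bar> \<le> 0"
    by (simp add: algebra_simps)
  then show ?thesis
    using q by (simp add: mult_le_0_iff)
qed

end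

section \<open>Equivalence with an operator equation of the second kind\<close>

lemma eq_iff_derivative_eq:
  fixes F G F' G' :: "real \<Rightarrow> real"
  assumes T: "0 < T" and "F 0 = G 0"
    and F: "\<And>t. t \<in> {0..T} \<Longrightarrow> (F has_real_derivative F' t) (at t within {0..T})"
    and G: "\<And>t. t \<in> {0..T} \<Longrightarrow> (G has_real_derivative G' t) (at t within {0..T})"
  shows "(\<forall>t\<in>{0<..T}. F t = G t) \<longleftrightarrow> (\<forall>t\<in>{0<..T}. F' t = G' t)"
proof
  assume eq: "\<forall>t\<in>{0<..T}. F t = G t"
  show "\<forall>t\<in>{0<..T}. F' t = G' t"
  proof
    fix t assume "t \<in> {0<..T}"
    then have t: "t \<in> {0..T}" by auto
    have "F s = G s" if "s \<in> {0..T}" for s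
      using eq assms(2) that by (cases "s = 0") auto
    then have "(G has_real_derivative F' t) (at t within {0..T})"
      by (intro has_field_derivative_transform_within[OF F[OF t] zero_less_one t])
    then show "F' t = G' t"
      using vector_derivative_within_closed_interval[OF T t] G[OF t]
      unfolding has_real_derivative_iff_has_vector_derivative by metis
  qed
next
  assume eq: "\<forall>t\<in>{0<..T}. F' t = G' t"
  have D: "((\<lambda>t. F t - G t) has_real_derivative F' t - G' t) (at t within {0..T})" if "t \<in> {0..T}" for t
    using that by (intro DERIV_diff F G)
  have "F t - G t = F 0 - G 0" if "t \<in> {0<..T}" for t
  proof (rule DERIV_isconst2[OF T])
    show "continuous_on {0..T} (\<lambda>t. F t - G t)"
      using D by (rule DERIV_continuous_on)
    show "((\<lambda>t. F t - G t) has_real_derivative 0) (at s)" if "0 < s" "s < T" for s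
      using D[of s] eq that by (simp add: at_within_Icc_at)
  qed (use that in auto)
  then show "\<forall>t\<in>{0<..T}. F t = G t"
    using assms(2) by auto
qed

context volterra_system
begin

lemma solves_equation_iff_volterra:
  assumes "continuous_on {0..T} y" and "\<And>t. 0 < t \<Longrightarrow> t \<le> T \<Longrightarrow> x t = y t"
  shows "solves_equation n \<alpha> K T f x \<longleftrightarrow> (\<forall>t\<in>{0<..T}. volterra y t = f t)"
  unfolding solves_equation_def
proof (rule ball_cong[OF refl])
  fix t assume "t \<in> {0<..T}"
  then have integral: "((\<lambda>s. piecewise_kernel n \<alpha> K t s * x s) has_integral volterra y t) {0..t}"
    by (intro has_integral_piecewise_kernel assms) simp_all
  show "((\<lambda>s. piecewise_kernel n \<alpha> K t s * x s) has_integral f t) {0..t} \<longleftrightarrow> volterra y t = f t"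
  proof
    show "volterra y t = f t" if "((\<lambda>s. piecewise_kernel n \<alpha> K t s * x s) has_integral f t) {0..t}"
      by (rule has_integral_unique[OF integral that])
  qed (use integral in simp)
qed

text \<open>
  By linearity the equation for \<open>x\<^sup>N + t\<^sup>N w\<close> says that the Volterra operator maps \<open>s\<^sup>N w(s)\<close> to the
  residual of \<open>x\<^sup>N\<close>.  Both sides vanish at \<open>0\<close>, so no information is lost by differentiating; dividing
  by \<open>t\<^sup>N K\<^sub>n(t,t)\<close> gives \<open>L w + V w = h\<close> for \<open>t > 0\<close>, and continuity extends this to \<open>t = 0\<close>.  The
  growth condition on the residual is exactly the continuity of \<open>h\<close> at \<open>0\<close>.
\<close>

lemma differentiated_equation:
  assumes f: "f \<in> C1_closed T" "f 0 = 0" and xN: "xN \<in> C_half_open T"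
    and small: "residual_deriv n \<alpha> K T f xN \<in> o[at_right 0](\<lambda>t. t ^ N)"
  defines "h \<equiv> h_fun n \<alpha> K T N f xN"
  shows "h \<in> \<C>"
    and "w \<in> \<C> \<Longrightarrow> solves_equation n \<alpha> K T f (\<lambda>t. xN t + t ^ N * w t) \<longleftrightarrow>
      (\<forall>t\<in>{0..T}. L w t + V w t = h t)"
proof -
  obtain f' where f': "continuous_on {0..T} f'"
    "\<And>t. t \<in> {0..T} \<Longrightarrow> (f has_real_derivative f' t) (at t within {0..T})"
    using f(1) by (auto simp: C1_closed_def)
  obtain l where x: "continuous_on {0<..T} xN" "(xN \<longlongrightarrow> l) (at_right 0)"
    using xN by (auto simp: C_half_open_def)
  define y where "y t = (if t = 0 then l else xN t)" for t
  have y: "continuous_on {0..T} y"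
    unfolding y_def using continuous_on_extend_at_0[OF T x] .
  define R where "R t = f' t - volterra_deriv y t" for t
  let ?r = "residual n \<alpha> K f xN"
  have R: "continuous_on {0..T} R"
    unfolding R_def by (intro continuous_on_diff f'(1) volterra_deriv_continuous y)
  have r_eq: "?r t = f t - volterra y t" if "t \<in> {0..T}" for t
  proof (cases "t = 0")
    case True
    then show ?thesis by (simp add: residual_def f(2))
  next
    case False
    with that have "((\<lambda>s. piecewise_kernel n \<alpha> K t s * xN s) has_integral volterra y t) {0..t}"
      by (intro has_integral_piecewise_kernel[OF y]) (auto simp: y_def)
    then show ?thesis
      by (simp add: residual_def integral_unique)
  qed
  have r_deriv: "(?r has_real_derivative R t) (at t within {0..T})" if t: "t \<in> {0..T}" for t
    using DERIV_diff[OF f'(2)[OF t] has_real_derivative_volterra[OF y t]] unfolding R_def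
    by (rule has_field_derivative_transform_within[OF _ zero_less_one t]) (simp add: r_eq)
  have R_eq: "residual_deriv n \<alpha> K T f xN t = R t" if t: "t \<in> {0..T}" for t
    unfolding residual_deriv_def
    using vector_derivative_within_closed_interval[OF T t] r_deriv[OF t]
    by (simp add: has_real_derivative_iff_has_vector_derivative)
  have "((\<lambda>t. residual_deriv n \<alpha> K T f xN t / t ^ N / K n t t) \<longlongrightarrow> 0 / K n 0 0) (at_right 0)"
    using continuous_on_tendsto_at_right_0[OF T Kn_continuous] Kn_nonzero[of 0] T
    by (intro tendsto_divide smalloD_tendsto[OF small]) auto
  then have lim: "((\<lambda>t. inverse (t ^ N) * residual_deriv n \<alpha> K T f xN t / K n t t) \<longlongrightarrow> 0) (at_right 0)"
    by (simp add: divide_inverse mult.commute)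
  have "continuous_on {0<..T} (\<lambda>t. inverse (t ^ N) * R t / K n t t)"
    using Kn_nonzero
    by (intro continuous_intros continuous_on_subset[OF R] continuous_on_subset[OF Kn_continuous]) auto
  then have "continuous_on {0<..T} (\<lambda>t. inverse (t ^ N) * residual_deriv n \<alpha> K T f xN t / K n t t)"
    by (rule continuous_on_eq) (simp add: R_eq)
  from continuous_on_extend_at_0[OF T this lim] show h: "h \<in> \<C>"
    unfolding h_def h_fun_def by (rule restrict_mem_C_closed)
  show "solves_equation n \<alpha> K T f (\<lambda>t. xN t + t ^ N * w t) \<longleftrightarrow> (\<forall>t\<in>{0..T}. L w t + V w t = h t)"
    if w: "w \<in> \<C>"
  proof -
    let ?z = "\<lambda>s. s ^ N * w s"
    have wc: "continuous_on {0..T} w"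
      using w by (simp add: mem_C_closed_iff)
    have z: "continuous_on {0..T} ?z"
      by (intro continuous_intros wc)
    have "solves_equation n \<alpha> K T f (\<lambda>t. xN t + t ^ N * w t) \<longleftrightarrow>
        (\<forall>t\<in>{0<..T}. volterra (\<lambda>s. y s + ?z s) t = f t)"
      by (intro solves_equation_iff_volterra continuous_on_add y z) (simp add: y_def)
    also have "\<dots> \<longleftrightarrow> (\<forall>t\<in>{0<..T}. volterra ?z t = ?r t)"
      by (intro ball_cong) (auto simp: volterra_add[OF y z] r_eq)
    also have "\<dots> \<longleftrightarrow> (\<forall>t\<in>{0<..T}. volterra_deriv ?z t = R t)"
      using r_eq[of 0] T f(2)
      by (intro eq_iff_derivative_eq has_real_derivative_volterra z r_deriv) auto
    also have "\<dots> \<longleftrightarrow> (\<forall>t\<in>{0<..T}. L w t + V w t = h t)"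
    proof (rule ball_cong[OF refl])
      fix t assume t: "t \<in> {0<..T}"
      then have nz: "t ^ N * K n t t \<noteq> 0"
        using Kn_nonzero[of t] by auto
      have "R t = t ^ N * K n t t * h t"
        using t nz by (simp add: h_def h_fun_def R_eq)
      then show "volterra_deriv ?z t = R t \<longleftrightarrow> L w t + V w t = h t"
        by (simp only: volterra_deriv_power_weight[OF t] mult_left_cancel[OF nz])
    qed
    also have "\<dots> \<longleftrightarrow> (\<forall>t\<in>{0..T}. L w t + V w t = h t)"
    proof
      assume eq: "\<forall>t\<in>{0<..T}. L w t + V w t = h t"
      have "continuous_on {0..T} (\<lambda>t. L w t + V w t)" "continuous_on {0..T} h"
        using bij_betwE[OF L_bij, rule_format, OF w] V_in_C[OF w] h unfolding mem_C_closed_iff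
        by (auto intro: continuous_on_add)
      then have "L w 0 + V w 0 = h 0"
        using continuous_on_Icc_eq_at_0[OF T] eq by blast
      then show "\<forall>t\<in>{0..T}. L w t + V w t = h t"
        using eq by (metis atLeastAtMost_iff greaterThanAtMost_iff order_le_less)
    qed auto
    finally show ?thesis .
  qed
qed

end

section \<open>Existence, uniqueness and convergence\<close>

theorem theorem1p1:
  fixes T :: real and n N :: nat and \<alpha> :: "nat \<Rightarrow> real"
    and K K' :: "nat \<Rightarrow> real \<Rightarrow> real \<Rightarrow> real"
    and f xN :: "real \<Rightarrow> real"
  assumes "T > 0" and "n \<ge> 1"
    and "\<alpha> 0 = 0" and "\<And>i. i < n \<Longrightarrow> \<alpha> i < \<alpha> (Suc i)" and "\<alpha> n = 1"
    and "\<And>i. i \<in> {1..n} \<Longrightarrow> C1_kernel T (K i) (K' i)"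
    and "condition_A n \<alpha> K T N"
    and "f \<in> C1_closed T" and "f 0 = 0"
    and "xN \<in> C_half_open T"
    and "residual_deriv n \<alpha> K T f xN \<in> o[at_right 0](\<lambda>t. t ^ N)"
  shows "\<exists>u\<in>mspace (C_closed T).
      (u \<longlongrightarrow> 0) (at_right 0) \<and>
      (\<lambda>t. xN t + t ^ N * u t) \<in> C_half_open T \<and>
      solves_equation n \<alpha> K T f (\<lambda>t. xN t + t ^ N * u t) \<and>
      (\<forall>w\<in>mspace (C_closed T).
         solves_equation n \<alpha> K T f (\<lambda>t. xN t + t ^ N * w t) \<longrightarrow> w = u) \<and>
      (\<forall>U. U 0 \<in> mspace (C_closed T) \<and>
           (\<forall>m. U (Suc m) = (\<lambda>t\<in>{0..T}. A_op n \<alpha> K K' T N (U m) t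
                                    + L\<^sub>0_inv n \<alpha> K T N (h_fun n \<alpha> K T N f xN) t)) \<longrightarrow>
           limitin (mtopology_of (C_closed T)) U u sequentially)"
proof -
  interpret volterra_system T n N \<alpha> K K'
    by unfold_locales (use assms(1-7) in auto)
  define h where "h = h_fun n \<alpha> K T N f xN"
  note eq = differentiated_equation[OF assms(8-11), folded h_def]
  obtain u where u: "u \<in> \<C>" "step h u = u"
    and fixed_unique: "\<And>w. w \<in> \<C> \<Longrightarrow> step h w = w \<Longrightarrow> w = u"
    and lim: "\<And>U. U 0 \<in> \<C> \<Longrightarrow> (\<And>m. U (Suc m) = step h (U m)) \<Longrightarrow>
       limitin (mtopology_of (C_closed T)) U u sequentially"
    using successive_approximations[OF eq(1)] by blast
  have uc: "continuous_on {0..T} u"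
    using u(1) by (simp add: mem_C_closed_iff)
  have u_eq: "\<forall>t\<in>{0..T}. L u t + V u t = h t"
    using u step_fixed_point_iff[OF eq(1) u(1)] by simp
  have "0 \<in> {0..T}"
    using T by simp
  from bspec[OF u_eq this] have "L u 0 + V u 0 = 0"
    using \<open>0 \<in> {0..T}\<close> unfolding h_def h_fun_def by simp
  then have "u 0 = 0"
    by (rule zero_at_0_if_homogeneous_at_0)
  then have u0: "(u \<longlongrightarrow> 0) (at_right 0)"
    using continuous_on_tendsto_at_right_0[OF T uc] by simp
  obtain l where x: "continuous_on {0<..T} xN" "(xN \<longlongrightarrow> l) (at_right 0)"
    using assms(10) by (auto simp: C_half_open_def)
  have "((\<lambda>t. xN t + t ^ N * u t) \<longlongrightarrow> l + 0 ^ N * 0) (at_right 0)"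
    by (intro tendsto_intros x u0)
  moreover have "continuous_on {0<..T} (\<lambda>t. xN t + t ^ N * u t)"
    by (intro continuous_intros x continuous_on_subset[OF uc]) auto
  ultimately have half_open: "(\<lambda>t. xN t + t ^ N * u t) \<in> C_half_open T"
    by (auto simp: C_half_open_def)
  have unique: "w = u" if w: "w \<in> \<C>" "solves_equation n \<alpha> K T f (\<lambda>t. xN t + t ^ N * w t)" for w
    using w eq(2)[OF w(1)] step_fixed_point_iff[OF eq(1) w(1)] by (intro fixed_unique) auto
  show ?thesis
    unfolding h_def[symmetric] step_def[symmetric]
    using u(1) u0 half_open eq(2)[OF u(1)] u_eq unique lim by blast
qed

end
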